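(* The ring $\mathcal{J}_2$ is an Ore domain.
   Context: $\mathbb{Z}_2$ is the ring of dyadic ($2$-adic) integers. $\mathbb{Z}_2[\xi_1,\dots,\xi_n]$ is graded by $\deg\xi_i=1$. $Jq$ is the $\mathbb{Z}_2$-algebra endomorphism with $Jq(1)=1$, $Jq(\xi_i)=\xi_i+\xi_i^2$. For $k\ge0$, $Jq^k$ is the $\mathbb{Z}_2$-linear map raising degree by $k$ obtained, on each degree $d$, by restricting $Jq$ to degree $d$ and projecting onto degree $d+k$; $Jq^0=1$. The dyadic Steenrod algebra $\mathcal{J}_2$ is the (non-commutative) $\mathbb{Z}_2$-algebra generated under composition by the $Jq^k$, $k\ge0$, two elements being equal when they agree as operators on $\mathbb{Z}_2[\xi_1,\dots,\xi_n]$ for every $n$. A ring $R$ satisfies the (right) Ore condition if for all $a\in R$ and $c\in R\setminus\{0\}$ there exist $b\in R$ and $d\in R\setminus\{0\}$ with $ad=cb$. An Ore domain is a ring without zero divisors satisfying the Ore condition. *)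

theory Defs
  imports "HOL-Library.Poly_Mapping" "HOL-Library.FuncSet" "HOL-Algebra.Ring"
begin

section \<open>The ring of dyadic integers\<close>

text \<open>
  The inverse limit of the rings of integers modulo \<open>2 ^ n\<close>: an element is a
  compatible sequence of residues, each given by its representative in \<open>{0..<2 ^ n}\<close>.
\<close>

typedef dyadic =
  "{f :: nat \<Rightarrow> int. \<forall>n. f n \<in> {0..<2 ^ n} \<and> f (Suc n) mod 2 ^ n = f n}"
  morphisms residue Abs_dyadic
  by (rule exI[of _ "\<lambda>_. 0"]) auto

setup_lifting type_definition_dyadic

lemma dyadic_mod_mod: "(x::int) mod 2 ^ Suc n mod 2 ^ n = x mod 2 ^ n"
  by (rule mod_mod_cancel) simp

instantiation dyadic :: comm_ring_1
begin

lift_definition zero_dyadic :: dyadic is "\<lambda>_. 0" by simp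

lift_definition one_dyadic :: dyadic is "\<lambda>n. 1 mod 2 ^ n"
  by (simp add: dyadic_mod_mod del: power_Suc)

lift_definition plus_dyadic :: "dyadic \<Rightarrow> dyadic \<Rightarrow> dyadic"
  is "\<lambda>f g n. (f n + g n) mod 2 ^ n"
  by (simp add: dyadic_mod_mod del: power_Suc) (metis mod_add_eq)

lift_definition uminus_dyadic :: "dyadic \<Rightarrow> dyadic"
  is "\<lambda>f n. (- f n) mod 2 ^ n"
  by (simp add: dyadic_mod_mod del: power_Suc) (metis mod_minus_eq)

lift_definition minus_dyadic :: "dyadic \<Rightarrow> dyadic \<Rightarrow> dyadic"
  is "\<lambda>f g n. (f n - g n) mod 2 ^ n"
  by (simp add: dyadic_mod_mod del: power_Suc) (metis mod_diff_eq)

lift_definition times_dyadic :: "dyadic \<Rightarrow> dyadic \<Rightarrow> dyadic"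
  is "\<lambda>f g n. (f n * g n) mod 2 ^ n"
  by (simp add: dyadic_mod_mod del: power_Suc) (metis mod_mult_eq)

instance
proof
  fix a b c :: dyadic
  show "a + b + c = a + (b + c)" by transfer (simp add: mod_simps add.assoc)
  show "a + b = b + a" by transfer (simp add: add.commute)
  show "0 + a = a" by transfer auto
  show "- a + a = 0" by transfer (simp add: mod_simps)
  show "a - b = a + - b" by transfer (simp add: mod_simps)
  show "a * b * c = a * (b * c)" by transfer (simp add: mod_simps mult.assoc)
  show "a * b = b * a" by transfer (simp add: mult.commute)
  show "1 * a = a"
    by transfer (intro ext, simp only: mod_mult_left_eq mult_1, auto intro: mod_pos_pos_trivial)
  show "(a + b) * c = a * c + b * c" by transfer (simp add: mod_simps distrib_right)
  show "(0::dyadic) \<noteq> 1" by transfer (auto simp: fun_eq_iff intro!: exI[of _ 1])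
qed

end

section \<open>Polynomials over the dyadic integers\<close>

text \<open>
  Polynomials in variables indexed by \<^typ>\<open>nat\<close>; \<open>dpolys n\<close> is the polynomial
  ring in the \<open>n\<close> variables with index in \<open>{1..n}\<close>.
\<close>

type_synonym dpoly = "(nat \<Rightarrow>\<^sub>0 nat) \<Rightarrow>\<^sub>0 dyadic"

definition dpolys :: "nat \<Rightarrow> dpoly set" where
  "dpolys n = {p. \<forall>m \<in> Poly_Mapping.keys p. Poly_Mapping.keys m \<subseteq> {1..n}}"

definition dconst :: "dyadic \<Rightarrow> dpoly" where
  "dconst c = Poly_Mapping.single 0 c"

definition dvar :: "nat \<Rightarrow> dpoly" where
  "dvar i = Poly_Mapping.single (Poly_Mapping.single i 1) 1"

definition mdeg :: "(nat \<Rightarrow>\<^sub>0 nat) \<Rightarrow> nat" where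
  "mdeg m = (\<Sum>i \<in> Poly_Mapping.keys m. Poly_Mapping.lookup m i)"

definition hcomp :: "nat \<Rightarrow> dpoly \<Rightarrow> dpoly" where
  "hcomp d p = (\<Sum>m \<in> {m \<in> Poly_Mapping.keys p. mdeg m = d}.
     Poly_Mapping.single m (Poly_Mapping.lookup p m))"

section \<open>The total operation and its homogeneous parts\<close>

definition Jq_mono :: "(nat \<Rightarrow>\<^sub>0 nat) \<Rightarrow> dpoly" where
  "Jq_mono m = (\<Prod>i \<in> Poly_Mapping.keys m. (dvar i + dvar i ^ 2) ^ Poly_Mapping.lookup m i)"

definition Jq :: "dpoly \<Rightarrow> dpoly" where
  "Jq p = (\<Sum>m \<in> Poly_Mapping.keys p. dconst (Poly_Mapping.lookup p m) * Jq_mono m)"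

text \<open>
  The following lemmas confirm that \<^const>\<open>Jq\<close> is the algebra endomorphism with
  \<open>dvar i \<mapsto> dvar i + dvar i ^ 2\<close>.
\<close>

lemma Jq_superset:
  assumes "finite A" "Poly_Mapping.keys p \<subseteq> A"
  shows "Jq p = (\<Sum>m\<in>A. dconst (Poly_Mapping.lookup p m) * Jq_mono m)"
  unfolding Jq_def using assms
  by (intro sum.mono_neutral_left) (auto simp: dconst_def in_keys_iff)

lemma Jq_add: "Jq (p + q) = Jq p + Jq q"
proof -
  let ?A = "Poly_Mapping.keys p \<union> Poly_Mapping.keys q"
  have "finite ?A" by simp
  then show ?thesis
    using Jq_superset[of ?A p] Jq_superset[of ?A q]
      Jq_superset[of ?A "p + q"] Poly_Mapping.keys_add[of p q]
    by (simp add: sum.distrib[symmetric] lookup_add single_add dconst_def distrib_right)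
qed

lemma dconst_mult: "dconst (c * d) = dconst c * dconst d"
  by (simp add: dconst_def mult_single)

lemma Jq_zero [simp]: "Jq 0 = 0"
  by (simp add: Jq_def)

lemma Jq_single: "Jq (Poly_Mapping.single m c) = dconst c * Jq_mono m"
  by (cases "c = 0") (simp_all add: Jq_def dconst_def)

lemma Jq_dconst: "Jq (dconst c) = dconst c"
  by (simp add: dconst_def Jq_single) (simp add: dconst_def Jq_mono_def)

lemma Jq_one: "Jq 1 = 1"
  using Jq_dconst[of 1] by (simp add: dconst_def)

lemma Jq_dvar: "Jq (dvar i) = dvar i + dvar i ^ 2"
  by (subst dvar_def, subst Jq_single) (simp add: dconst_def Jq_mono_def)

lemma Jq_mono_superset:
  assumes "finite A" "Poly_Mapping.keys m \<subseteq> A"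
  shows "Jq_mono m = (\<Prod>i\<in>A. (dvar i + dvar i ^ 2) ^ Poly_Mapping.lookup m i)"
  unfolding Jq_mono_def using assms
  by (intro prod.mono_neutral_left) (auto simp: in_keys_iff)

lemma Jq_mono_add: "Jq_mono (m + m') = Jq_mono m * Jq_mono m'"
proof -
  let ?A = "Poly_Mapping.keys m \<union> Poly_Mapping.keys m'"
  have "finite ?A" by simp
  then show ?thesis
    using Jq_mono_superset[of ?A m] Jq_mono_superset[of ?A m']
      Jq_mono_superset[of ?A "m + m'"] Poly_Mapping.keys_add[of m m']
    by (simp add: prod.distrib[symmetric] lookup_add power_add)
qed

lemma dpoly_induct [case_names zero add_single]:
  fixes p :: dpoly
  assumes "P 0" "\<And>m c p. P p \<Longrightarrow> P (Poly_Mapping.single m c + p)"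
  shows "P p"
proof (induction p rule: Poly_Mapping.update_induct)
  case (update f a b)
  have "Poly_Mapping.update a b f = Poly_Mapping.single a b + f"
    using update by (intro poly_mapping_eqI)
      (auto simp: lookup_update lookup_add lookup_single when_def in_keys_iff)
  then show ?case using assms(2) update by simp
qed (use assms in \<open>simp\<close>)

lemma Jq_mult: "Jq (p * q) = Jq p * Jq q"
proof (induction p rule: dpoly_induct)
  case (add_single m c p)
  have "Jq (Poly_Mapping.single m c * q) = Jq (Poly_Mapping.single m c) * Jq q"
  proof (induction q rule: dpoly_induct)
    case (add_single m' c' q)
    then show ?case
      by (simp add: distrib_left Jq_add mult_single Jq_single Jq_mono_add dconst_mult mult_ac)
  qed simp
  then show ?case using add_single by (simp add: distrib_right Jq_add)
qed simp

text \<open>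
  Only the finitely many degrees \<open>d\<close> that occur in \<open>p\<close> contribute to the sum.
\<close>

definition Jqpow :: "nat \<Rightarrow> dpoly \<Rightarrow> dpoly" where
  "Jqpow k p = (\<Sum>d \<in> mdeg ` Poly_Mapping.keys p. hcomp (d + k) (Jq (hcomp d p)))"

section \<open>The dyadic Steenrod algebra\<close>

text \<open>
  An element is a family, indexed by the number \<open>n\<close> of variables, of operators on
  \<open>dpolys n\<close>.  Each operator is \<^const>\<open>restrict\<close>ed to \<open>dpolys n\<close>, so that equality
  of families is agreement on \<open>dpolys n\<close> for every \<open>n\<close>.
\<close>

type_synonym dop = "nat \<Rightarrow> dpoly \<Rightarrow> dpoly"

definition dop_Jq :: "nat \<Rightarrow> dop" where
  "dop_Jq k = (\<lambda>n. restrict (Jqpow k) (dpolys n))"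

definition dop_zero :: dop where
  "dop_zero = (\<lambda>n. \<lambda>p \<in> dpolys n. 0)"

definition dop_one :: dop where
  "dop_one = (\<lambda>n. \<lambda>p \<in> dpolys n. p)"

definition dop_add :: "dop \<Rightarrow> dop \<Rightarrow> dop" where
  "dop_add F G = (\<lambda>n. \<lambda>p \<in> dpolys n. F n p + G n p)"

definition dop_smult :: "dyadic \<Rightarrow> dop \<Rightarrow> dop" where
  "dop_smult c F = (\<lambda>n. \<lambda>p \<in> dpolys n. dconst c * F n p)"

definition dop_comp :: "dop \<Rightarrow> dop \<Rightarrow> dop" where
  "dop_comp F G = (\<lambda>n. compose (dpolys n) (F n) (G n))"

inductive_set J2_carrier :: "dop set" where
  gen: "dop_Jq k \<in> J2_carrier"
| add: "F \<in> J2_carrier \<Longrightarrow> G \<in> J2_carrier \<Longrightarrow> dop_add F G \<in> J2_carrier"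
| smult: "F \<in> J2_carrier \<Longrightarrow> dop_smult c F \<in> J2_carrier"
| comp: "F \<in> J2_carrier \<Longrightarrow> G \<in> J2_carrier \<Longrightarrow> dop_comp F G \<in> J2_carrier"

definition J2 :: "dop ring" where
  "J2 = \<lparr>carrier = J2_carrier, mult = dop_comp, one = dop_one,
         zero = dop_zero, add = dop_add\<rparr>"

section \<open>Ore domains\<close>

definition right_ore :: "('a, 'b) ring_scheme \<Rightarrow> bool" where
  "right_ore R \<longleftrightarrow>
     (\<forall>a \<in> carrier R. \<forall>c \<in> carrier R - {\<zero>\<^bsub>R\<^esub>}.
        \<exists>b \<in> carrier R. \<exists>d \<in> carrier R - {\<zero>\<^bsub>R\<^esub>}. a \<otimes>\<^bsub>R\<^esub> d = c \<otimes>\<^bsub>R\<^esub> b)"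

text \<open>
  The library's \<^locale>\<open>domain\<close> is commutative, hence the conditions are spelled out;
  as there, the zero ring is excluded.
\<close>

definition ore_domain :: "('a, 'b) ring_scheme \<Rightarrow> bool" where
  "ore_domain R \<longleftrightarrow>
     Ring.ring R \<and> \<one>\<^bsub>R\<^esub> \<noteq> \<zero>\<^bsub>R\<^esub> \<and>
     (\<forall>a \<in> carrier R. \<forall>b \<in> carrier R.
        a \<otimes>\<^bsub>R\<^esub> b = \<zero>\<^bsub>R\<^esub> \<longrightarrow> a = \<zero>\<^bsub>R\<^esub> \<or> b = \<zero>\<^bsub>R\<^esub>) \<and>
     right_ore R"

end

(*
  Every element of J2 commutes with renaming of variables, and its coefficient from x^m to
  x^e does not change when both monomials are multiplied by one in other variables. Hence it
  is determined by the coefficients at x_1^(1+a_1) ... x_n^(1+a_n), all a_i > 0, of its value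
  on x_1 ... x_n. They depend only on the multiset {a_1, ..., a_n}, whose sum is bounded by
  the degree of the operator.

  Domain: if T and U have orders r and s (largest multiset size with a nonzero coefficient),
  then on x_1 ... x_(r+s) the top coefficients of T o U are obtained by letting U act on s of
  the variables and T on the remaining r. Taking the largest multisets in a linear order that
  is compatible with addition exhibits a nonzero coefficient.

  Ore condition (Jategaonkar): if a J2 and c J2 met only in 0, the 2^k words of length k in
  a and c would be linearly independent, but they live in degree O(k), where the number of
  multisets is subexponential in k.
*)

theory Submission
  imports Defs "HOL-Library.Multiset_Order" "HOL-Computational_Algebra.Primes"
begin

abbreviation "lookup \<equiv> Poly_Mapping.lookup"
abbreviation "keys \<equiv> Poly_Mapping.keys"
abbreviation "single \<equiv> Poly_Mapping.single"

section \<open>Dyadic integers form a domain of characteristic zero\<close>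

lemma residue_mod:
  assumes "n \<le> m"
  shows "residue x m mod 2 ^ n = residue x n"
  using assms
proof (induction m rule: dec_induct)
  case base
  show ?case using residue[of x] by auto
next
  case (step m)
  have "residue x (Suc m) mod 2 ^ n = residue x (Suc m) mod 2 ^ m mod 2 ^ n"
    using step.hyps by (simp add: mod_mod_cancel le_imp_power_dvd)
  also have "residue x (Suc m) mod 2 ^ m = residue x m"
    using residue[of x] by blast
  finally show ?case using step.IH by simp
qed

text \<open>A nonzero dyadic integer has finite 2-adic valuation: once the residue modulo
  \<open>2 ^ n\<close> is nonzero, compatibility keeps \<open>2 ^ n\<close> from dividing any later
  residue.\<close>

lemma dyadic_nonzero_residue:
  assumes "x \<noteq> 0"
  obtains n where "\<And>m. n \<le> m \<Longrightarrow> \<not> 2 ^ n dvd residue x m"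
proof -
  obtain n where n: "residue x n \<noteq> 0"
    using assms by (metis residue_inject zero_dyadic.rep_eq ext)
  have "\<not> 2 ^ n dvd residue x m" if "n \<le> m" for m
    using n residue_mod[OF that, of x] by (auto simp: dvd_eq_mod_eq_0)
  then show ?thesis using that by blast
qed

instance dyadic :: idom
proof
  fix x y :: dyadic
  assume "x \<noteq> 0" "y \<noteq> 0"
  obtain n where n: "\<And>m. n \<le> m \<Longrightarrow> \<not> 2 ^ n dvd residue x m"
    using dyadic_nonzero_residue[OF \<open>x \<noteq> 0\<close>] by blast
  obtain k where k: "\<And>m. k \<le> m \<Longrightarrow> \<not> 2 ^ k dvd residue y m"
    using dyadic_nonzero_residue[OF \<open>y \<noteq> 0\<close>] by blast
  \<comment> \<open>The valuations are below \<open>n\<close> and \<open>k\<close>, so that of the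
    product is below \<open>n + k\<close>: otherwise primality of 2 would split the exponent and
    give one factor at least its excluded share.\<close>
  have "\<not> 2 ^ (n + k) dvd residue x (n + k) * residue y (n + k)"
  proof
    assume "2 ^ (n + k) dvd residue x (n + k) * residue y (n + k)"
    then have "\<exists>a b. a + b = n + k \<and> 2 ^ a dvd residue x (n + k) \<and> 2 ^ b dvd residue y (n + k)"
      by (rule prime_elem_power_dvd_prod) (simp add: prime_imp_prime_elem)
    then obtain a b where ab: "a + b = n + k" "2 ^ a dvd residue x (n + k)"
        "2 ^ b dvd residue y (n + k)"
      by blast
    show False
    proof (cases "n \<le> a")
      case True
      then show False using ab(2) n[of "n + k"] le_imp_power_dvd[OF True, of "2 :: int"]
        by (meson dvd_trans le_add1)
    next
      case False
      then have "k \<le> b" using ab(1) by simp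
      then show False using ab(3) k[of "n + k"] le_imp_power_dvd[of k b "2 :: int"]
        by (meson dvd_trans le_add2)
    qed
  qed
  then have "residue (x * y) (n + k) \<noteq> 0"
    by (simp add: times_dyadic.rep_eq dvd_eq_mod_eq_0)
  then show "x * y \<noteq> 0" by (auto simp: zero_dyadic.rep_eq)
qed

lemma residue_of_nat: "residue (of_nat k) n = int k mod 2 ^ n"
  by (induction k) (simp_all add: zero_dyadic.rep_eq one_dyadic.rep_eq plus_dyadic.rep_eq mod_simps)

text \<open>The leading coefficient of a composite will carry a positive integer factor, which must
  not vanish.\<close>

instance dyadic :: ring_char_0
proof
  have "of_nat k \<noteq> (0 :: dyadic)" if "k > 0" for k
  proof
    assume "of_nat k = (0 :: dyadic)"
    \<comment> \<open>Level \<open>k\<close> suffices: as \<open>k < 2 ^ k\<close>, the residue of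
      \<open>k\<close> there is \<open>k\<close> itself.\<close>
    then have "int k mod 2 ^ k = 0"
      by (metis residue_of_nat zero_dyadic.rep_eq)
    moreover have "int k < 2 ^ k" using less_exp[of k] by (metis of_nat_less_iff of_nat_numeral of_nat_power)
    ultimately show False using that by simp
  qed
  then have *: "of_nat (k - l) \<noteq> (0 :: dyadic)" if "l < k" for k l
    using that zero_less_diff by blast
  show "inj (of_nat :: nat \<Rightarrow> dyadic)"
  proof (rule linorder_injI)
    fix l k :: nat
    assume "l < k"
    then show "of_nat l \<noteq> (of_nat k :: dyadic)" using *[of l k] by (auto simp: of_nat_diff)
  qed
qed

section \<open>Polynomials\<close>

lemma poly_sum_singles: "p = (\<Sum>m\<in>keys p. single m (lookup p m))"
  by (rule poly_mapping_eqI) (simp add: lookup_sum lookup_single when_def in_keys_iff)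

lemma lookup_dconst_mult [simp]: "lookup (dconst c * p) e = c * lookup p e"
  by (simp add: dconst_def mult_map_scale_conv_mult[symmetric] Poly_Mapping.map.rep_eq when_def)

lemma dconst_mult_single: "dconst c * single m d = single m (c * d)"
  by (simp add: dconst_def mult_single)

lemma dconst_zero [simp]: "dconst 0 = 0" and dconst_one [simp]: "dconst 1 = 1"
  by (simp_all add: dconst_def)

lemma lookup_hcomp: "lookup (hcomp d p) e = (if mdeg e = d then lookup p e else 0)"
  by (simp add: hcomp_def lookup_sum lookup_single when_def in_keys_iff if_distrib cong: if_cong)

text \<open>If the exponent splits in only one way between the two supports, the convolution reduces
  to one term.\<close>

lemma lookup_mult_unique:
  fixes p q :: "('a::cancel_comm_monoid_add) \<Rightarrow>\<^sub>0 ('b::comm_semiring_0)"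
  assumes "\<And>a b. a \<in> keys p \<Longrightarrow> b \<in> keys q \<Longrightarrow> a + b = a0 + b0 \<Longrightarrow> a = a0 \<and> b = b0"
  shows "lookup (p * q) (a0 + b0) = lookup p a0 * lookup q b0"
proof -
  have "p * q = (\<Sum>a\<in>keys p. single a (lookup p a)) * (\<Sum>b\<in>keys q. single b (lookup q b))"
    using poly_sum_singles[of p] poly_sum_singles[of q] by simp
  also have "\<dots> = (\<Sum>a\<in>keys p. \<Sum>b\<in>keys q. single (a + b) (lookup p a * lookup q b))"
    by (simp add: sum_product mult_single)
  finally have "lookup (p * q) (a0 + b0) =
      (\<Sum>a\<in>keys p. \<Sum>b\<in>keys q. lookup p a * lookup q b when a + b = a0 + b0)"
    by (simp add: lookup_sum lookup_single)
  also have "\<dots> = (\<Sum>a\<in>keys p. \<Sum>b\<in>keys q. if b = b0 then (if a = a0 then lookup p a * lookup q b else 0) else 0)"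
    using assms by (intro sum.cong refl) (auto simp: when_def)
  also have "\<dots> = lookup p a0 * lookup q b0"
    by (cases "lookup q b0 = 0") (auto simp: in_keys_iff)
  finally show ?thesis .
qed

section \<open>Degree and renaming of variables\<close>

lemma mdeg_superset:
  assumes "finite A" "keys m \<subseteq> A"
  shows "mdeg m = (\<Sum>i\<in>A. lookup m i)"
  unfolding mdeg_def using assms by (intro sum.mono_neutral_left) (auto simp: in_keys_iff)

lemma mdeg_add: "mdeg (m + m') = mdeg m + mdeg m'"
proof -
  let ?A = "keys m \<union> keys m'"
  have "finite ?A" by simp
  then show ?thesis
    using mdeg_superset[of ?A m] mdeg_superset[of ?A m'] mdeg_superset[of ?A "m + m'"]
      Poly_Mapping.keys_add[of m m'] by (simp add: lookup_add sum.distrib)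
qed

lemma mdeg_zero [simp]: "mdeg 0 = 0" and mdeg_single [simp]: "mdeg (single i k) = k"
  by (simp_all add: mdeg_def)

section \<open>Renaming and identification of variables\<close>

definition rename_mono :: "(nat \<Rightarrow> nat) \<Rightarrow> (nat \<Rightarrow>\<^sub>0 nat) \<Rightarrow> (nat \<Rightarrow>\<^sub>0 nat)" where
  "rename_mono h m = (\<Sum>i\<in>keys m. single (h i) (lookup m i))"

text \<open>\<open>h\<close> may identify variables; the coefficients of monomials with a common
  image then add up.\<close>

definition rename :: "(nat \<Rightarrow> nat) \<Rightarrow> dpoly \<Rightarrow> dpoly" where
  "rename h p = (\<Sum>m\<in>keys p. single (rename_mono h m) (lookup p m))"

lemma rename_mono_superset:
  assumes "finite A" "keys m \<subseteq> A"
  shows "rename_mono h m = (\<Sum>i\<in>A. single (h i) (lookup m i))"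
  unfolding rename_mono_def using assms by (intro sum.mono_neutral_left) (auto simp: in_keys_iff)

lemma rename_mono_zero [simp]: "rename_mono h 0 = 0"
  and rename_mono_single [simp]: "rename_mono h (single i k) = single (h i) k"
  by (simp_all add: rename_mono_def)

lemma rename_mono_add: "rename_mono h (m + m') = rename_mono h m + rename_mono h m'"
proof -
  let ?A = "keys m \<union> keys m'"
  have "finite ?A" by simp
  then show ?thesis
    using rename_mono_superset[of ?A m] rename_mono_superset[of ?A m']
      rename_mono_superset[of ?A "m + m'"] Poly_Mapping.keys_add[of m m']
    by (simp add: lookup_add sum.distrib single_add)
qed

lemma rename_superset:
  assumes "finite A" "keys p \<subseteq> A"
  shows "rename h p = (\<Sum>m\<in>A. single (rename_mono h m) (lookup p m))"
  unfolding rename_def using assms by (intro sum.mono_neutral_left) (auto simp: in_keys_iff)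

lemma rename_zero [simp]: "rename h 0 = 0"
  and rename_single [simp]: "rename h (single m c) = single (rename_mono h m) c"
  by (simp_all add: rename_def)

lemma rename_add: "rename h (p + q) = rename h p + rename h q"
proof -
  let ?A = "keys p \<union> keys q"
  have "finite ?A" by simp
  then show ?thesis
    using rename_superset[of ?A p] rename_superset[of ?A q]
      rename_superset[of ?A "p + q"] Poly_Mapping.keys_add[of p q]
    by (simp add: lookup_add sum.distrib single_add)
qed

lemma rename_mult: "rename h (p * q) = rename h p * rename h q"
proof (induction p rule: dpoly_induct)
  case (add_single m c p)
  have "rename h (single m c * q) = rename h (single m c) * rename h q"
    by (induction q rule: dpoly_induct)
      (simp_all add: distrib_left rename_add mult_single rename_mono_add)
  then show ?case using add_single by (simp add: distrib_right rename_add)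
qed simp

lemma rename_dconst_mult: "rename h (dconst c * p) = dconst c * rename h p"
  by (simp add: rename_mult) (simp add: dconst_def)

lemma mdeg_rename_mono [simp]: "mdeg (rename_mono h m) = mdeg m"
proof -
  have *: "mdeg (sum f A) = (\<Sum>a\<in>A. mdeg (f a))" for f :: "nat \<Rightarrow> _" and A
    by (induction A rule: infinite_finite_induct) (simp_all add: mdeg_add)
  show ?thesis unfolding rename_mono_def * mdeg_single by (simp add: mdeg_def)
qed

lemma hcomp_zero [simp]: "hcomp d 0 = 0"
  by (simp add: hcomp_def)

lemma hcomp_add: "hcomp d (p + q) = hcomp d p + hcomp d q"
  by (rule poly_mapping_eqI) (simp add: lookup_hcomp lookup_add)

lemma hcomp_single: "hcomp d (single m c) = (if mdeg m = d then single m c else 0)"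
  by (rule poly_mapping_eqI) (auto simp: lookup_hcomp lookup_single when_def)

lemma hcomp_dconst_mult: "hcomp d (dconst c * p) = dconst c * hcomp d p"
  by (rule poly_mapping_eqI) (simp add: lookup_hcomp)

lemma rename_hcomp: "rename h (hcomp d p) = hcomp d (rename h p)"
  by (induction p rule: dpoly_induct) (simp_all add: hcomp_add rename_add hcomp_single)

text \<open>Both sides are multiplicative in the monomial, which leaves powers of a single
  variable.\<close>

lemma rename_Jq_mono: "rename h (Jq_mono m) = Jq_mono (rename_mono h m)"
proof -
  have J1: "Jq_mono 0 = 1" by (simp add: Jq_mono_def)
  have *: "Jq_mono (sum f A) = (\<Prod>a\<in>A. Jq_mono (f a))" for f :: "nat \<Rightarrow> _" and A
    by (induction A rule: infinite_finite_induct) (simp_all add: Jq_mono_add J1)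
  have r1: "rename h 1 = 1" by (simp flip: single_one)
  have pow: "rename h (p ^ k) = rename h p ^ k" for p k
    by (induction k) (simp_all add: r1 rename_mult)
  have prd: "rename h (prod f A) = (\<Prod>a\<in>A. rename h (f a))" for f :: "nat \<Rightarrow> _" and A
    by (induction A rule: infinite_finite_induct) (simp_all add: r1 rename_mult)
  have sng: "Jq_mono (single i k) = (dvar i + dvar i ^ 2) ^ k" for i k
    by (cases "k = 0") (simp_all add: J1 Jq_mono_def)
  have dv: "rename h (dvar i) = dvar (h i)" for i by (simp add: dvar_def)
  show ?thesis
    unfolding rename_mono_def * sng by (simp add: Jq_mono_def prd pow rename_add dv)
qed

section \<open>The operators \<open>Jqpow\<close>\<close>

lemma Jqpow_superset:
  assumes "finite A" "mdeg ` keys p \<subseteq> A"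
  shows "Jqpow k p = (\<Sum>d\<in>A. hcomp (d + k) (Jq (hcomp d p)))"
  unfolding Jqpow_def
proof (intro sum.mono_neutral_left ballI)
  fix d assume "d \<in> A - mdeg ` keys p"
  then have "{m \<in> keys p. mdeg m = d} = {}" by auto
  then have "hcomp d p = 0" unfolding hcomp_def by (metis sum.empty)
  then show "hcomp (d + k) (Jq (hcomp d p)) = 0" by simp
qed (use assms in auto)

lemma Jqpow_add: "Jqpow k (p + q) = Jqpow k p + Jqpow k q"
proof -
  let ?A = "mdeg ` keys p \<union> mdeg ` keys q"
  have "finite ?A" by simp
  moreover have "mdeg ` keys (p + q) \<subseteq> ?A" using Poly_Mapping.keys_add[of p q] by blast
  ultimately show ?thesis
    using Jqpow_superset[of ?A p] Jqpow_superset[of ?A q] Jqpow_superset[of ?A "p + q"]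
    by (simp add: hcomp_add Jq_add sum.distrib)
qed

lemma Jqpow_single: "Jqpow k (single m c) = dconst c * hcomp (mdeg m + k) (Jq_mono m)"
  by (cases "c = 0") (simp_all add: Jqpow_def hcomp_single Jq_single hcomp_dconst_mult)

lemma Jqpow_zero [simp]: "Jqpow k 0 = 0"
  by (simp add: Jqpow_def)

lemma Jqpow_dconst_mult: "Jqpow k (dconst c * p) = dconst c * Jqpow k p"
  by (induction p rule: dpoly_induct)
    (simp_all add: distrib_left Jqpow_add dconst_mult_single Jqpow_single dconst_mult mult.assoc)

lemma rename_Jqpow: "rename h (Jqpow k p) = Jqpow k (rename h p)"
  by (induction p rule: dpoly_induct)
    (simp_all add: Jqpow_add rename_add Jqpow_single rename_dconst_mult rename_hcomp rename_Jq_mono)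

section \<open>Natural operators\<close>

definition op_coeff :: "(dpoly \<Rightarrow> dpoly) \<Rightarrow> (nat \<Rightarrow>\<^sub>0 nat) \<Rightarrow> (nat \<Rightarrow>\<^sub>0 nat) \<Rightarrow> dyadic" where
  "op_coeff T m e = lookup (T (single m 1)) e"

text \<open>An axiomatic hull of the algebra, closed under its operations. Monomials go to
  combinations of multiples of themselves in the same variables, with degree raised by at most
  \<open>D\<close>; \<open>coeff_stable\<close> says that variables untouched by the passage from
  \<open>m\<close> to \<open>e\<close> do not influence the coefficient.\<close>

locale natural_op =
  fixes T :: "dpoly \<Rightarrow> dpoly" and D :: nat
  assumes add: "T (p + q) = T p + T q"
    and scale: "T (dconst c * p) = dconst c * T p"
    and rename: "T (rename h p) = rename h (T p)"
    and coeff_keys: "op_coeff T m e \<noteq> 0 \<Longrightarrow> keys e \<subseteq> keys m"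
    and coeff_le: "op_coeff T m e \<noteq> 0 \<Longrightarrow> lookup m i \<le> lookup e i"
    and coeff_mdeg: "op_coeff T m e \<noteq> 0 \<Longrightarrow> mdeg e \<le> mdeg m + D"
    and coeff_stable: "keys m' \<inter> keys m = {} \<Longrightarrow> keys m' \<inter> keys e = {} \<Longrightarrow>
      op_coeff T (m + m') (e + m') = op_coeff T m e"
begin

lemma zero [simp]: "T 0 = 0"
  using add[of 0 0] by simp

lemma apply_sum: "T (sum f A) = (\<Sum>a\<in>A. T (f a))"
  by (induction A rule: infinite_finite_induct) (simp_all add: add)

lemma lookup_apply: "lookup (T p) e = (\<Sum>m\<in>keys p. lookup p m * op_coeff T m e)"
proof -
  have "T p = T (\<Sum>m\<in>keys p. dconst (lookup p m) * single m 1)"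
    by (simp add: dconst_mult_single flip: poly_sum_singles)
  then show ?thesis
    by (simp add: apply_sum scale lookup_sum op_coeff_def)
qed

lemma apply_eq_zeroI: "(\<And>m e. op_coeff T m e = 0) \<Longrightarrow> T p = 0"
  by (rule poly_mapping_eqI) (simp add: lookup_apply)

lemma keys_apply: "p \<in> dpolys n \<Longrightarrow> T p \<in> dpolys n"
proof -
  assume p: "p \<in> dpolys n"
  have "keys e \<subseteq> {1..n}" if "e \<in> keys (T p)" for e
  proof -
    have "(\<Sum>m\<in>keys p. lookup p m * op_coeff T m e) \<noteq> 0"
      using that lookup_apply[of p e] by (simp add: in_keys_iff)
    then obtain m where "m \<in> keys p" "op_coeff T m e \<noteq> 0"
      by (metis (no_types, lifting) mult_zero_right sum.neutral)
    then show ?thesis using p coeff_keys unfolding dpolys_def by blast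
  qed
  then show ?thesis unfolding dpolys_def by blast
qed

lemma mono: "D \<le> E \<Longrightarrow> natural_op T E"
  by unfold_locales (auto simp: add scale rename coeff_stable dest: coeff_keys coeff_le coeff_mdeg)

end

section \<open>Closure of natural operators under sums, scalars and composition\<close>

lemma op_coeff_add: "op_coeff (\<lambda>p. T p + U p) m e = op_coeff T m e + op_coeff U m e"
  and op_coeff_scale: "op_coeff (\<lambda>p. dconst c * T p) m e = c * op_coeff T m e"
  by (simp_all add: op_coeff_def lookup_add)

lemma op_coeff_comp:
  assumes "natural_op T D"
  shows "op_coeff (T \<circ> U) m e =
    (\<Sum>x\<in>keys (U (single m 1)). op_coeff U m x * op_coeff T x e)"
proof -
  have "lookup (T (U (single m 1))) e =
      (\<Sum>x\<in>keys (U (single m 1)). lookup (U (single m 1)) x * op_coeff T x e)"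
    by (rule natural_op.lookup_apply[OF assms])
  then show ?thesis by (simp add: op_coeff_def)
qed

lemma in_keys_op: "x \<in> keys (U (single m 1)) \<longleftrightarrow> op_coeff U m x \<noteq> 0"
  by (simp add: op_coeff_def in_keys_iff)

lemma natural_op_add:
  assumes "natural_op T D" "natural_op U E"
  shows "natural_op (\<lambda>p. T p + U p) (max D E)"
proof -
  interpret T: natural_op T "max D E" using assms(1) natural_op.mono by force
  interpret U: natural_op U "max D E" using assms(2) natural_op.mono by force
  have nz: "op_coeff T m e \<noteq> 0 \<or> op_coeff U m e \<noteq> 0"
    if "op_coeff (\<lambda>p. T p + U p) m e \<noteq> 0" for m e
    using that by (auto simp: op_coeff_add)
  show ?thesis
  proof
    fix m e :: "nat \<Rightarrow>\<^sub>0 nat" and i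
    assume "op_coeff (\<lambda>p. T p + U p) m e \<noteq> 0"
    note nz = nz[OF this]
    show "keys e \<subseteq> keys m" using nz T.coeff_keys U.coeff_keys by blast
    show "lookup m i \<le> lookup e i" using nz T.coeff_le U.coeff_le by blast
    show "mdeg e \<le> mdeg m + max D E" using nz T.coeff_mdeg U.coeff_mdeg by blast
  next
    fix p q
    show "T (p + q) + U (p + q) = T p + U p + (T q + U q)" by (simp add: T.add U.add add_ac)
  qed (simp_all add: T.scale U.scale T.rename U.rename T.coeff_stable U.coeff_stable
      op_coeff_add rename_add distrib_left)
qed

lemma natural_op_scale:
  assumes "natural_op T D"
  shows "natural_op (\<lambda>p. dconst c * T p) D"
proof -
  interpret T: natural_op T D by fact
  show ?thesis
    by unfold_locales (auto simp: T.add T.scale T.rename T.coeff_stable op_coeff_scale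
        rename_dconst_mult distrib_left mult.left_commute dest: T.coeff_keys T.coeff_le T.coeff_mdeg)
qed

text \<open>Coefficients of a composite form a matrix product over the intermediate monomial
  \<open>x\<close>. The work lies in stability, where multiplication by \<open>m'\<close> has to
  match the intermediate monomials on both sides.\<close>

lemma natural_op_comp:
  assumes "natural_op T D" "natural_op U E"
  shows "natural_op (T \<circ> U) (D + E)"
proof -
  interpret T: natural_op T D by fact
  interpret U: natural_op U E by fact
  note comp = op_coeff_comp[OF assms(1)]
  have nz: "\<exists>x. op_coeff U m x \<noteq> 0 \<and> op_coeff T x e \<noteq> 0" if "op_coeff (T \<circ> U) m e \<noteq> 0" for m e
    using that unfolding comp by (metis (no_types, lifting) mult_eq_0_iff sum.neutral)
  show ?thesis
  proof
    fix m e :: "nat \<Rightarrow>\<^sub>0 nat" and i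
    assume "op_coeff (T \<circ> U) m e \<noteq> 0"
    then obtain x where x: "op_coeff U m x \<noteq> 0" "op_coeff T x e \<noteq> 0" using nz by blast
    show "keys e \<subseteq> keys m" using U.coeff_keys[OF x(1)] T.coeff_keys[OF x(2)] by blast
    show "lookup m i \<le> lookup e i"
      using U.coeff_le[OF x(1)] T.coeff_le[OF x(2)] le_trans by blast
    show "mdeg e \<le> mdeg m + (D + E)"
      using U.coeff_mdeg[OF x(1)] T.coeff_mdeg[OF x(2)] by simp
  next
    fix m' m e :: "nat \<Rightarrow>\<^sub>0 nat"
    assume disj: "keys m' \<inter> keys m = {}" "keys m' \<inter> keys e = {}"
    let ?g = "\<lambda>x. x + m'"
    let ?A = "keys (U (single (m + m') 1))"
    let ?B = "keys (U (single m 1))"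
    have stab: "op_coeff U (m + m') (x + m') = op_coeff U m x"
      "op_coeff T (x + m') (e + m') = op_coeff T x e" if "keys m' \<inter> keys x = {}" for x
      using that disj by (auto intro: U.coeff_stable T.coeff_stable)
    have disjB: "keys m' \<inter> keys x = {}" if "x \<in> ?B" for x
      using that disj U.coeff_keys by (fastforce simp: in_keys_op)
    have "op_coeff (T \<circ> U) (m + m') (e + m') =
        (\<Sum>x\<in>?A. op_coeff U (m + m') x * op_coeff T x (e + m'))"
      by (rule comp)
    also have "\<dots> = (\<Sum>x\<in>?g ` ?B. op_coeff U (m + m') x * op_coeff T x (e + m'))"
    proof (rule sum.mono_neutral_right)
      show "?g ` ?B \<subseteq> ?A" using stab(1) disjB by (auto simp: in_keys_op)
      show "\<forall>x\<in>?A - ?g ` ?B. op_coeff U (m + m') x * op_coeff T x (e + m') = 0"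
      proof (rule ballI, rule ccontr)
        fix x assume x: "x \<in> ?A - ?g ` ?B"
          and "op_coeff U (m + m') x * op_coeff T x (e + m') \<noteq> 0"
        then have nz: "op_coeff U (m + m') x \<noteq> 0" "op_coeff T x (e + m') \<noteq> 0" by auto
        \<comment> \<open>The divisibilities \<open>m + m'\<close> into \<open>x\<close> into
          \<open>e + m'\<close> pin the exponents of \<open>x\<close> on the variables of
          \<open>m'\<close>, so \<open>x - m'\<close> avoids these variables and is a true
          difference.\<close>
        have le: "lookup m i + lookup m' i \<le> lookup x i" "lookup x i \<le> lookup e i + lookup m' i" for i
          using U.coeff_le[OF nz(1), of i] T.coeff_le[OF nz(2), of i] by (simp_all add: lookup_add)
        have eq: "(x - m') + m' = x"
          by (rule poly_mapping_eqI)
            (simp add: lookup_add lookup_minus add_leD2[OF le(1)])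
        have "keys m' \<inter> keys (x - m') = {}"
        proof (rule ccontr)
          assume "keys m' \<inter> keys (x - m') \<noteq> {}"
          then obtain i where "i \<in> keys m'" "i \<in> keys (x - m')" by blast
          then have i: "i \<in> keys m'" "lookup x i \<noteq> lookup m' i"
            by (auto simp: in_keys_iff lookup_minus)
          then have "lookup m i = 0" "lookup e i = 0" using disj by (auto simp: in_keys_iff)
          then show False using le[of i] i(2) by simp
        qed
        then have "op_coeff U m (x - m') \<noteq> 0" using stab(1)[of "x - m'"] nz eq by simp
        then have "x \<in> ?g ` ?B" using eq by (force simp: in_keys_op)
        then show False using x by blast
      qed
    qed simp
    also have "\<dots> = (\<Sum>x\<in>?B. op_coeff U (m + m') (x + m') * op_coeff T (x + m') (e + m'))"
      by (subst sum.reindex) (auto simp: inj_on_def)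
    also have "\<dots> = op_coeff (T \<circ> U) m e"
      unfolding comp by (rule sum.cong) (simp_all add: stab disjB)
    finally show "op_coeff (T \<circ> U) (m + m') (e + m') = op_coeff (T \<circ> U) m e" .
  qed (simp_all add: T.add U.add T.scale U.scale T.rename U.rename)
qed

section \<open>Coefficients of the total operation on monomials\<close>

lemma Jq_mono_single: "Jq_mono (single i 1) = dvar i + dvar i ^ 2"
  by (simp add: Jq_mono_def)

lemma mono_induct [case_names zero add_var]:
  fixes m :: "nat \<Rightarrow>\<^sub>0 nat"
  assumes "P 0" "\<And>m i. P m \<Longrightarrow> P (m + single i 1)"
  shows "P m"
proof -
  have *: "P (m + single i k)" if "P m" for m i k
  proof (induction k)
    case 0
    show ?case using that by simp
  next
    case (Suc k)
    then have "P (m + single i k + single i 1)" by (rule assms(2))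
    also have "m + single i k + single i 1 = m + single i (Suc k)"
      by (simp add: add.assoc flip: single_add)
    finally show ?case .
  qed
  show ?thesis
  proof (induction m rule: Poly_Mapping.update_induct)
    case (update f a b)
    have "Poly_Mapping.update a b f = f + single a b"
      using update by (intro poly_mapping_eqI)
        (auto simp: lookup_update lookup_add lookup_single when_def in_keys_iff)
    then show ?case using * update by simp
  qed (use assms in simp)
qed

text \<open>Each factor \<open>dvar i + dvar i ^ 2\<close> contributes one or two copies of the same
  variable.\<close>

lemma keys_Jq_mono:
  "e \<in> keys (Jq_mono m) \<Longrightarrow> keys e \<subseteq> keys m \<and> (\<forall>i. lookup m i \<le> lookup e i)"
proof (induction m arbitrary: e rule: mono_induct)
  case zero
  then show ?case by (simp add: Jq_mono_def)
next
  case (add_var m i)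
  have sq: "dvar i ^ 2 = single (single i 2) 1"
    by (simp add: dvar_def power2_eq_square mult_single numeral_2_eq_2 flip: single_add)
  obtain a b where ab: "e = a + b" "a \<in> keys (Jq_mono m)" "b \<in> keys (dvar i + dvar i ^ 2)"
    using add_var.prems Poly_Mapping.keys_mult
    unfolding Jq_mono_add Jq_mono_single by blast
  have b: "b = single i 1 \<or> b = single i 2"
    using ab(3) Poly_Mapping.keys_add[of "dvar i" "dvar i ^ 2"] unfolding sq by (auto simp: dvar_def)
  note IH = add_var.IH[OF ab(2)]
  have "lookup (single i 1) j \<le> lookup b j" for j
    using b by (auto simp: lookup_single when_def)
  then have le: "lookup (m + single i 1) j \<le> lookup e j" for j
    using IH unfolding ab(1) lookup_add by (simp add: add_mono)
  have "keys b \<subseteq> {i}" using b by (auto split: if_splits)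
  then have "keys e \<subseteq> keys m \<union> {i}"
    using IH Poly_Mapping.keys_add[of a b] unfolding ab(1) by blast
  also have "\<dots> \<subseteq> keys (m + single i 1)"
    by (auto simp: in_keys_iff lookup_add)
  finally show ?case using le by blast
qed

text \<open>The monomial itself arises only by choosing the linear term, of coefficient 1, in every
  factor.\<close>

lemma lookup_Jq_mono_self: "lookup (Jq_mono m) m = 1"
proof (induction m rule: mono_induct)
  case (add_var m i)
  have "lookup (Jq_mono m * Jq_mono (single i 1)) (m + single i 1) =
      lookup (Jq_mono m) m * lookup (Jq_mono (single i 1)) (single i 1)"
  proof (rule lookup_mult_unique)
    fix a b assume a: "a \<in> keys (Jq_mono m)" and b: "b \<in> keys (Jq_mono (single i 1))"
      and eq: "a + b = m + single i 1"
    have le: "lookup m j \<le> lookup a j" "lookup (single i 1) j \<le> lookup b j"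
      "lookup a j + lookup b j = lookup m j + lookup (single i 1) j" for j
      using keys_Jq_mono[OF a] keys_Jq_mono[OF b] eq by (auto simp flip: lookup_add)
    have "lookup a j = lookup m j \<and> lookup b j = lookup (single i 1) j" for j
      using le[of j] by linarith
    then show "a = m \<and> b = single i 1" by (auto intro!: poly_mapping_eqI)
  qed
  moreover have "lookup (dvar i ^ 2) (single i 1) = 0"
    by (auto simp: dvar_def power2_eq_square mult_single lookup_single when_def poly_mapping_eq_iff
        fun_eq_iff simp flip: single_add)
  ultimately show ?case
    using add_var unfolding Jq_mono_add Jq_mono_single lookup_add by (simp add: dvar_def)
qed (simp add: Jq_mono_def)

lemma op_coeff_Jqpow:
  "op_coeff (Jqpow k) m e = (if mdeg e = mdeg m + k then lookup (Jq_mono m) e else 0)"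
  by (simp add: op_coeff_def Jqpow_single lookup_hcomp)

lemma natural_op_Jqpow: "natural_op (Jqpow k) k"
proof
  fix m' m e :: "nat \<Rightarrow>\<^sub>0 nat"
  assume disj: "keys m' \<inter> keys m = {}" "keys m' \<inter> keys e = {}"
  \<comment> \<open>The variables of \<open>m\<close> and \<open>m'\<close> are disjoint, so the
    factor \<open>m'\<close> can only come from \<open>Jq_mono m'\<close>, where its coefficient is
    1.\<close>
  have "lookup (Jq_mono m * Jq_mono m') (e + m') = lookup (Jq_mono m) e * lookup (Jq_mono m') m'"
  proof (rule lookup_mult_unique)
    fix a b assume a: "a \<in> keys (Jq_mono m)" and b: "b \<in> keys (Jq_mono m')" and eq: "a + b = e + m'"
    have lk: "lookup a j + lookup b j = lookup e j + lookup m' j" for j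
      using eq by (auto simp flip: lookup_add)
    have "lookup a j = lookup e j \<and> lookup b j = lookup m' j" for j
    proof (cases "j \<in> keys m'")
      case True
      then have "j \<notin> keys a" "j \<notin> keys e" using disj keys_Jq_mono[OF a] by auto
      then show ?thesis using lk[of j] by (simp add: in_keys_iff)
    next
      case False
      then have "j \<notin> keys b" using keys_Jq_mono[OF b] by auto
      then show ?thesis using lk[of j] False by (simp add: in_keys_iff)
    qed
    then show "a = e \<and> b = m'" by (auto intro!: poly_mapping_eqI)
  qed
  then show "op_coeff (Jqpow k) (m + m') (e + m') = op_coeff (Jqpow k) m e"
    by (simp add: op_coeff_Jqpow Jq_mono_add lookup_Jq_mono_self mdeg_add)
next
  fix m e :: "nat \<Rightarrow>\<^sub>0 nat" and i
  assume "op_coeff (Jqpow k) m e \<noteq> 0"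
  then have *: "e \<in> keys (Jq_mono m)" "mdeg e = mdeg m + k"
    by (auto simp: op_coeff_Jqpow in_keys_iff split: if_splits)
  show "keys e \<subseteq> keys m" "lookup m i \<le> lookup e i" using keys_Jq_mono[OF *(1)] by auto
  show "mdeg e \<le> mdeg m + k" using * by simp
qed (simp_all add: Jqpow_add Jqpow_dconst_mult rename_Jqpow)

text \<open>Supplies the unit, which is not a generation rule of its own.\<close>

lemma Jqpow_0: "Jqpow 0 = id"
proof
  fix p
  have *: "hcomp (mdeg m) (Jq_mono m) = single m 1" for m
  proof (rule poly_mapping_eqI)
    fix e
    \<comment> \<open>No exponent of \<open>e\<close> is below that of \<open>m\<close>, so equal
      total degree forces equality.\<close>
    have "e = m" if "mdeg e = mdeg m" "e \<in> keys (Jq_mono m)"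
    proof -
      have sub: "keys e \<subseteq> keys m" and le: "\<And>i. lookup m i \<le> lookup e i"
        using keys_Jq_mono[OF that(2)] by auto
      have "(\<Sum>i\<in>keys m. lookup m i) = (\<Sum>i\<in>keys m. lookup e i)"
        using that(1) mdeg_superset[OF _ sub] by (simp add: mdeg_def)
      then have "lookup m i = lookup e i" if "i \<in> keys m" for i
        using sum_mono_inv[of "lookup m" "keys m" "lookup e" i] le that by auto
      then show ?thesis
        using sub by (intro poly_mapping_eqI) (metis in_keys_iff subsetD)
    qed
    then show "lookup (hcomp (mdeg m) (Jq_mono m)) e = lookup (single m 1) e"
      by (auto simp: lookup_hcomp lookup_single when_def lookup_Jq_mono_self in_keys_iff)
  qed
  show "Jqpow 0 p = id p"
    by (induction p rule: dpoly_induct) (simp_all add: Jqpow_add Jqpow_single * dconst_mult_single)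
qed

section \<open>Coefficients on square-free monomials\<close>

definition monom_of :: "nat set \<Rightarrow> (nat \<Rightarrow> nat) \<Rightarrow> (nat \<Rightarrow>\<^sub>0 nat)" where
  "monom_of A f = (\<Sum>i\<in>A. single i (f i))"

lemma lookup_monom_of: "finite A \<Longrightarrow> lookup (monom_of A f) i = (if i \<in> A then f i else 0)"
  by (simp add: monom_of_def lookup_sum lookup_single when_def)

lemma keys_monom_of: "finite A \<Longrightarrow> keys (monom_of A f) = {i \<in> A. f i \<noteq> 0}"
  by (auto simp: in_keys_iff lookup_monom_of split: if_splits)

lemma monom_of_lookup: "finite A \<Longrightarrow> keys m \<subseteq> A \<Longrightarrow> monom_of A (lookup m) = m"
  by (rule poly_mapping_eqI) (auto simp: lookup_monom_of in_keys_iff)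

lemma mdeg_monom_of: "finite A \<Longrightarrow> mdeg (monom_of A f) = (\<Sum>i\<in>A. f i)"
  using mdeg_superset[of A "monom_of A f"] by (simp add: keys_monom_of lookup_monom_of)

lemma rename_mono_sum: "rename_mono h (sum f A) = (\<Sum>a\<in>A. rename_mono h (f a))"
  by (induction A rule: infinite_finite_induct) (simp_all add: rename_mono_add)

lemma rename_monom_of:
  assumes "inj_on h A"
  shows "rename_mono h (monom_of A (\<lambda>i. f (h i))) = monom_of (h ` A) f"
  by (simp add: monom_of_def rename_mono_sum sum.reindex[OF assms])

lemma lookup_rename_mono_inj:
  assumes "inj_on h K" "keys m \<subseteq> K" "i \<in> K"
  shows "lookup (rename_mono h m) (h i) = lookup m i"
proof -
  have "lookup (rename_mono h m) (h i) = (\<Sum>j\<in>keys m. if j = i then lookup m j else 0)"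
    unfolding rename_mono_def lookup_sum lookup_single
    using assms by (intro sum.cong) (auto simp: when_def inj_on_def)
  then show ?thesis by (simp add: in_keys_iff)
qed

text \<open>Injectivity on the variables that occur keeps distinct monomials distinct, so no
  coefficients merge.\<close>

lemma lookup_rename_inj:
  assumes "inj_on h K" "keys e \<subseteq> K" "\<And>m. m \<in> keys q \<Longrightarrow> keys m \<subseteq> K"
  shows "lookup (rename h q) (rename_mono h e) = lookup q e"
proof -
  have eq: "m = e" if "m \<in> keys q" "rename_mono h m = rename_mono h e" for m
  proof (rule poly_mapping_eqI)
    fix i
    show "lookup m i = lookup e i"
    proof (cases "i \<in> K")
      case True
      then show ?thesis
        using lookup_rename_mono_inj[OF assms(1)] assms(2,3) that by metis
    next
      case False
      then show ?thesis using assms(2,3) that(1) by (metis in_keys_iff subsetD)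
    qed
  qed
  have "lookup (rename h q) (rename_mono h e) = (\<Sum>m\<in>keys q. if m = e then lookup q m else 0)"
    unfolding rename_def lookup_sum lookup_single
    using eq by (intro sum.cong) (auto simp: when_def)
  then show ?thesis by (simp add: in_keys_iff)
qed

text \<open>An entry of \<open>M\<close> is the excess of an exponent over 1, hence the
  \<open>Suc\<close>. Sorting merely chooses an arrangement; the value is the same for all of them
  by \<open>coeff_eq_type_coeff\<close>.\<close>

definition type_coeff :: "(dpoly \<Rightarrow> dpoly) \<Rightarrow> nat multiset \<Rightarrow> dyadic" where
  "type_coeff T M = op_coeff T (monom_of {..<size M} (\<lambda>_. 1))
     (monom_of {..<size M} (\<lambda>i. Suc (sorted_list_of_multiset M ! i)))"

text \<open>The list names the variables with multiplicity, so \<open>(!) ys\<close> is the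
  substitution that turns a square-free monomial into \<open>m\<close>.\<close>

lemma list_monom: "\<exists>ys. (m :: nat \<Rightarrow>\<^sub>0 nat) = (\<Sum>j<length ys. single (ys ! j) (1 :: nat))"
proof (induction m rule: mono_induct)
  case zero
  show ?case by (rule exI[of _ "[]"]) simp
next
  case (add_var m i)
  then obtain ys where "m = (\<Sum>j<length ys. single (ys ! j) 1)" by blast
  then show ?case by (intro exI[of _ "ys @ [i]"]) (simp add: nth_append)
qed

context natural_op
begin

lemma coeff_transport:
  assumes "finite B" "inj_on h B"
  shows "op_coeff T (monom_of B (\<lambda>_. 1)) (monom_of B (\<lambda>i. f (h i))) =
    op_coeff T (monom_of (h ` B) (\<lambda>_. 1)) (monom_of (h ` B) f)"
proof -
  have "T (single (monom_of (h ` B) (\<lambda>_. 1)) 1) = rename h (T (single (monom_of B (\<lambda>_. 1)) 1))"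
    using rename[of h "single (monom_of B (\<lambda>_. 1)) 1"] rename_monom_of[OF assms(2), of "\<lambda>_. 1"] by simp
  moreover have "lookup (rename h (T (single (monom_of B (\<lambda>_. 1)) 1)))
      (rename_mono h (monom_of B (\<lambda>i. f (h i)))) =
      lookup (T (single (monom_of B (\<lambda>_. 1)) 1)) (monom_of B (\<lambda>i. f (h i)))"
  proof (rule lookup_rename_inj[OF assms(2)])
    fix m assume "m \<in> keys (T (single (monom_of B (\<lambda>_. 1)) 1))"
    then have "keys m \<subseteq> keys (monom_of B (\<lambda>_. 1))" unfolding in_keys_op by (rule coeff_keys)
    then show "keys m \<subseteq> B" using assms(1) by (auto simp: keys_monom_of)
  qed (use assms(1) in \<open>auto simp: keys_monom_of\<close>)
  ultimately show ?thesis
    unfolding op_coeff_def rename_monom_of[OF assms(2), symmetric] by simp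
qed

lemma coeff_eq_type_coeff:
  assumes "finite A"
  shows "op_coeff T (monom_of A (\<lambda>_. 1)) (monom_of A (\<lambda>i. Suc (g i))) =
    type_coeff T (image_mset g (mset_set A))"
proof -
  let ?M = "image_mset g (mset_set A)"
  \<comment> \<open>Listing \<open>A\<close> by increasing \<open>g\<close> makes
    \<open>(!) ys\<close> a bijection under which position \<open>j\<close> carries the
    \<open>j\<close>-th entry of the sorted multiset.\<close>
  define ys where "ys = sort_key g (sorted_list_of_set A)"
  have ys: "set ys = A" "distinct ys" "mset ys = mset_set A"
    using assms by (auto simp: ys_def simp flip: mset_set_set)
  have "mset (map g ys) = ?M" using ys(3) by simp
  moreover have "sorted (map g ys)" by (simp add: ys_def)
  ultimately have xs: "sorted_list_of_multiset ?M = map g ys"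
    by (metis sorted_list_of_multiset_mset sorted_sort_id)
  have n: "size ?M = length ys" by (metis size_image_mset size_mset ys(3))
  have inj: "inj_on ((!) ys) {..<length ys}" by (simp add: inj_on_nth ys(2))
  have img: "(!) ys ` {..<length ys} = A" using ys(1) by (auto simp: set_conv_nth)
  have "monom_of {..<length ys} (\<lambda>i. Suc (sorted_list_of_multiset ?M ! i)) =
      monom_of {..<length ys} (\<lambda>i. Suc (g (ys ! i)))"
    by (simp add: monom_of_def xs)
  then show ?thesis
    using coeff_transport[OF _ inj, of "\<lambda>i. Suc (g i)"] img n by (simp add: type_coeff_def)
qed

text \<open>Variables whose exponent stays 1 form a common factor, which stability removes.\<close>

lemma coeff_eq_type_coeff_pos:
  assumes "finite A"
  shows "op_coeff T (monom_of A (\<lambda>_. 1)) (monom_of A (\<lambda>i. Suc (g i))) =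
    type_coeff T (image_mset g (mset_set {i \<in> A. 0 < g i}))"
proof -
  let ?B = "{i \<in> A. 0 < g i}" and ?C = "{i \<in> A. g i = 0}"
  have fin: "finite ?B" "finite ?C" using assms by auto
  have split: "monom_of A f = monom_of ?B f + monom_of ?C f" for f
    unfolding monom_of_def using assms
    by (subst sum.union_disjoint[symmetric]) (auto intro!: sum.cong)
  have C: "monom_of ?C (\<lambda>i. Suc (g i)) = monom_of ?C (\<lambda>_. 1)" by (simp add: monom_of_def)
  show ?thesis
    unfolding split C coeff_eq_type_coeff[OF fin(1), symmetric]
    using fin by (intro coeff_stable) (auto simp: keys_monom_of)
qed

lemma coeff_squarefree_form:
  assumes "finite A" "op_coeff T (monom_of A (\<lambda>_. 1)) e \<noteq> 0"
  shows "e = monom_of A (\<lambda>i. Suc (lookup e i - 1))"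
proof -
  have "keys e \<subseteq> A" using coeff_keys[OF assms(2)] assms(1) by (auto simp: keys_monom_of)
  moreover have "Suc (lookup e i - 1) = lookup e i" if "i \<in> A" for i
    using coeff_le[OF assms(2), of i] that assms(1) by (simp add: lookup_monom_of)
  ultimately show ?thesis
    using assms(1) by (intro poly_mapping_eqI) (auto simp: lookup_monom_of in_keys_iff)
qed

text \<open>Every monomial comes from a square-free one by identifying variables; by equivariance a
  nonzero coefficient at \<open>e\<close> requires one at some \<open>e'\<close> above it.\<close>

lemma coeff_factor:
  assumes "op_coeff T m e \<noteq> 0"
  obtains ys e' where "m = rename_mono ((!) ys) (monom_of {..<length ys} (\<lambda>_. 1))"
    "e = rename_mono ((!) ys) e'" "op_coeff T (monom_of {..<length ys} (\<lambda>_. 1)) e' \<noteq> 0"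
proof -
  obtain ys where ys: "m = (\<Sum>j<length ys. single (ys ! j) (1 :: nat))" using list_monom by blast
  let ?u = "monom_of {..<length ys} (\<lambda>_. 1)"
  have m: "m = rename_mono ((!) ys) ?u" by (simp add: ys monom_of_def rename_mono_sum)
  have "T (single m 1) = rename ((!) ys) (T (single ?u 1))"
    using rename[of "(!) ys" "single ?u 1"] m by simp
  then have "(\<Sum>x\<in>keys (T (single ?u 1)).
      lookup (T (single ?u 1)) x when rename_mono ((!) ys) x = e) \<noteq> 0"
    using assms by (simp add: op_coeff_def rename_def lookup_sum lookup_single)
  then obtain x where "x \<in> keys (T (single ?u 1))"
      "(lookup (T (single ?u 1)) x when rename_mono ((!) ys) x = e) \<noteq> 0"
    by (rule sum.not_neutral_contains_not_neutral)
  then have "rename_mono ((!) ys) x = e" "op_coeff T ?u x \<noteq> 0"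
    by (auto simp: in_keys_op)
  then show ?thesis using that[OF m, of x] by simp
qed

text \<open>A nonzero coefficient lifts to a square-free monomial, and discarding the exponents
  equal to 1 leaves a multiset without zeros.\<close>

lemma coeff_zero_if_type_coeff_zero:
  assumes "\<And>M. 0 \<notin># M \<Longrightarrow> type_coeff T M = 0"
  shows "op_coeff T m e = 0"
proof (rule ccontr)
  assume "op_coeff T m e \<noteq> 0"
  then obtain ys :: "nat list" and e' where
    e': "op_coeff T (monom_of {..<length ys} (\<lambda>_. 1)) e' \<noteq> 0" by (rule coeff_factor)
  let ?g = "\<lambda>i. lookup e' i - 1"
  have "type_coeff T (image_mset ?g (mset_set {i \<in> {..<length ys}. 0 < ?g i})) = 0"
    by (rule assms) auto
  then show False
    using coeff_eq_type_coeff_pos[of "{..<length ys}" ?g] coeff_squarefree_form[OF _ e'] e' by simp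
qed

text \<open>The sum of the type is exactly the increase in degree.\<close>

lemma type_coeff_sum_le:
  assumes "type_coeff T M \<noteq> 0"
  shows "sum_mset M \<le> D"
proof -
  let ?xs = "sorted_list_of_multiset M"
  have n: "size M = length ?xs" by (metis mset_sorted_list_of_multiset size_mset)
  have "(\<Sum>i<size M. Suc (?xs ! i)) \<le> (\<Sum>i<size M. 1) + D"
    using coeff_mdeg[OF assms[unfolded type_coeff_def]] by (simp add: mdeg_monom_of)
  then have "(\<Sum>i<length ?xs. ?xs ! i) \<le> D"
    unfolding n by (simp add: sum.distrib flip: One_nat_def add: Suc_eq_plus1)
  also have "(\<Sum>i<length ?xs. ?xs ! i) = sum_list ?xs"
    by (simp add: sum_list_sum_nth atLeast0LessThan)
  also have "\<dots> = sum_mset M" by (metis mset_sorted_list_of_multiset sum_mset_sum_list)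
  finally show ?thesis .
qed

text \<open>The order bounds how many variables are raised. In a square-free lift at most
  \<open>r\<close> variables are raised, and identifying variables cannot increase their
  number.\<close>

lemma coeff_order:
  assumes "\<And>M. 0 \<notin># M \<Longrightarrow> type_coeff T M \<noteq> 0 \<Longrightarrow> size M \<le> r" and "op_coeff T m e \<noteq> 0"
  shows "card {i. lookup m i < lookup e i} \<le> r"
proof -
  obtain ys e' where m: "m = rename_mono ((!) ys) (monom_of {..<length ys} (\<lambda>_. 1))"
    and e: "e = rename_mono ((!) ys) e'"
    and nz: "op_coeff T (monom_of {..<length ys} (\<lambda>_. 1)) e' \<noteq> 0"
    using coeff_factor[OF assms(2)] by metis
  let ?A = "{..<length ys}" and ?g = "\<lambda>i. lookup e' i - 1"
  let ?P = "{i \<in> ?A. 0 < ?g i}"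
  have e': "e' = monom_of ?A (\<lambda>i. Suc (?g i))" using coeff_squarefree_form[OF _ nz] by simp
  have "type_coeff T (image_mset ?g (mset_set ?P)) \<noteq> 0"
    using nz coeff_eq_type_coeff_pos[of ?A ?g] e' by auto
  moreover have "0 \<notin># image_mset ?g (mset_set ?P)" by auto
  ultimately have "size (image_mset ?g (mset_set ?P)) \<le> r" by (rule assms(1)[rotated])
  then have le: "card ?P \<le> r" by simp
  have "{i. lookup m i < lookup e i} \<subseteq> (!) ys ` ?P"
  proof
    fix i assume i: "i \<in> {i. lookup m i < lookup e i}"
    show "i \<in> (!) ys ` ?P"
    proof (rule ccontr)
      assume no: "i \<notin> (!) ys ` ?P"
      \<comment> \<open>If no variable above \<open>i\<close> is raised, each contributes exactly 1,
        as it does to \<open>m\<close>.\<close>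
      have "lookup e i = (\<Sum>j<length ys. Suc (?g j) when ys ! j = i)"
        unfolding e by (subst e') (simp add: monom_of_def rename_mono_sum lookup_sum lookup_single)
      also have "\<dots> = (\<Sum>j<length ys. 1 when ys ! j = i)"
        using no by (intro sum.cong refl) (force simp: when_def)
      also have "\<dots> = lookup m i"
        unfolding m by (simp add: monom_of_def rename_mono_sum lookup_sum lookup_single)
      finally show False using i by simp
    qed
  qed
  then have "card {i. lookup m i < lookup e i} \<le> card ((!) ys ` ?P)"
    by (intro card_mono) auto
  also have "\<dots> \<le> card ?P" by (rule card_image_le) simp
  finally show ?thesis using le by simp
qed

end

section \<open>Top-order coefficients of a composite\<close>

lemma monom_of_split:
  assumes "finite A" "B \<subseteq> A"
  shows "monom_of A f = monom_of B f + monom_of (A - B) f"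
  unfolding monom_of_def using assms by (simp add: sum.subset_diff add.commute)

lemma monom_of_cong: "(\<And>i. i \<in> A \<Longrightarrow> f i = g i) \<Longrightarrow> monom_of A f = monom_of A g"
  by (simp add: monom_of_def)

text \<open>
  If all exponents of the target exceed one and the number of variables is the sum of the
  orders, then \<open>U\<close> and \<open>T\<close> must act on complementary sets of variables.
\<close>

lemma type_coeff_comp:
  fixes A :: "nat set"
  assumes T: "natural_op T D" and U: "natural_op U E"
    and r: "\<And>M. 0 \<notin># M \<Longrightarrow> type_coeff T M \<noteq> 0 \<Longrightarrow> size M \<le> r"
    and s: "\<And>M. 0 \<notin># M \<Longrightarrow> type_coeff U M \<noteq> 0 \<Longrightarrow> size M \<le> s"
    and A: "finite A" "card A = r + s" and pos: "\<And>i. i \<in> A \<Longrightarrow> 0 < g i"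
  shows "type_coeff (T \<circ> U) (image_mset g (mset_set A)) =
    (\<Sum>B | B \<subseteq> A \<and> card B = s. type_coeff U (image_mset g (mset_set B)) *
      type_coeff T (image_mset g (mset_set (A - B))))"
proof -
  interpret T: natural_op T D by fact
  interpret U: natural_op U E by fact
  interpret TU: natural_op "T \<circ> U" "D + E" using T U by (rule natural_op_comp)
  let ?u = "monom_of A (\<lambda>_. 1)" and ?e = "monom_of A (\<lambda>i. Suc (g i))"
  \<comment> \<open>\<open>?x B\<close> is the stage at which \<open>U\<close> has fully raised the
    variables in \<open>B\<close> and left the others at 1.\<close>
  let ?x = "\<lambda>B. monom_of A (\<lambda>i. if i \<in> B then Suc (g i) else 1)"
  let ?S = "{B. B \<subseteq> A \<and> card B = s}" and ?K = "keys (U (single ?u 1))"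
  let ?f = "\<lambda>x. op_coeff U ?u x * op_coeff T x ?e"
  have finS: "finite ?S" using A(1) by simp
  have x: "x \<in> ?x ` ?S" if nz: "op_coeff U ?u x \<noteq> 0" "op_coeff T x ?e \<noteq> 0" for x
  proof -
    let ?B = "{i. lookup ?u i < lookup x i}" and ?C = "{i. lookup x i < lookup ?e i}"
    have keys: "keys x \<subseteq> A" using U.coeff_keys[OF nz(1)] A(1) by (auto simp: keys_monom_of)
    have le: "1 \<le> lookup x i" "lookup x i \<le> Suc (g i)" if "i \<in> A" for i
      using U.coeff_le[OF nz(1), of i] T.coeff_le[OF nz(2), of i] that A(1)
      by (simp_all add: lookup_monom_of)
    have BA: "?B \<subseteq> A" and CA: "?C \<subseteq> A"
      using keys A(1) by (auto simp: lookup_monom_of in_keys_iff split: if_splits)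
    have AB: "A \<subseteq> ?B \<union> ?C"
    proof
      fix i assume "i \<in> A"
      then show "i \<in> ?B \<union> ?C" using le[of i] pos[of i] A(1) by (auto simp: lookup_monom_of)
    qed
    have cB: "card ?B \<le> s" and cC: "card ?C \<le> r"
      using U.coeff_order[OF s nz(1)] T.coeff_order[OF r nz(2)] by auto
    have fin: "finite ?B" "finite ?C" using BA CA A(1) finite_subset by blast+
    have "?B \<union> ?C = A" using AB BA CA by blast
    \<comment> \<open>Every exponent must rise, so the variables raised by \<open>U\<close> and by
      \<open>T\<close> cover \<open>A\<close>. Their numbers are at most \<open>s\<close> and
      \<open>r\<close> while \<open>card A = r + s\<close>, so the two sets are disjoint and the
      bounds are attained.\<close>
    then have "card ?B + card ?C = r + s + card (?B \<inter> ?C)"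
      using card_Un_Int[OF fin] A(2) by simp
    then have "card ?B = s" "card (?B \<inter> ?C) = 0" using cB cC by linarith+
    then have Bs: "?B \<in> ?S" and disj: "?B \<inter> ?C = {}" using BA fin by auto
    have "x = ?x ?B"
    proof (rule poly_mapping_eqI)
      fix i
      show "lookup x i = lookup (?x ?B) i"
      proof (cases "i \<in> A")
        case True
        then have "i \<notin> ?B \<or> i \<notin> ?C" using disj by blast
        then show ?thesis using le[OF True] True A(1) by (auto simp: lookup_monom_of)
      next
        case False
        then show ?thesis using keys A(1) by (auto simp: lookup_monom_of in_keys_iff)
      qed
    qed
    then show ?thesis using Bs by blast
  qed
  have inj: "inj_on ?x ?S"
  proof (rule inj_onI)
    fix B C assume BC: "B \<in> ?S" "C \<in> ?S" and eq: "?x B = ?x C"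
    have "i \<in> B \<longleftrightarrow> i \<in> C" if "i \<in> A" for i
      using arg_cong[OF eq, of "\<lambda>m. lookup m i"] that pos[OF that] A(1)
      by (auto simp: lookup_monom_of split: if_splits)
    then show "B = C" using BC by blast
  qed
  have summand: "?f (?x B) = type_coeff U (image_mset g (mset_set B)) *
      type_coeff T (image_mset g (mset_set (A - B)))" if "B \<in> ?S" for B
  proof -
    have BA: "B \<subseteq> A" and fin: "finite B" "finite (A - B)"
      using that A(1) finite_subset by auto
    have xB: "?x B = monom_of B (\<lambda>i. Suc (g i)) + monom_of (A - B) (\<lambda>_. 1)"
      unfolding monom_of_split[OF A(1) BA] by (intro arg_cong2[where f = "(+)"] monom_of_cong) auto
    have "op_coeff U ?u (?x B) = op_coeff U (monom_of B (\<lambda>_. 1)) (monom_of B (\<lambda>i. Suc (g i)))"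
      unfolding xB monom_of_split[OF A(1) BA, of "\<lambda>_. 1"]
      using fin by (intro U.coeff_stable) (auto simp: keys_monom_of)
    moreover have "op_coeff T (?x B) ?e =
        op_coeff T (monom_of (A - B) (\<lambda>_. 1)) (monom_of (A - B) (\<lambda>i. Suc (g i)))"
      unfolding xB monom_of_split[OF A(1) BA, of "\<lambda>i. Suc (g i)"]
        add.commute[of "monom_of B (\<lambda>i. Suc (g i))"]
      using fin by (intro T.coeff_stable) (auto simp: keys_monom_of)
    ultimately show ?thesis
      by (simp only: U.coeff_eq_type_coeff[OF fin(1)] T.coeff_eq_type_coeff[OF fin(2)])
  qed
  have "type_coeff (T \<circ> U) (image_mset g (mset_set A)) = (\<Sum>x\<in>?K. ?f x)"
    using TU.coeff_eq_type_coeff[OF A(1), of g] op_coeff_comp[OF T, of U ?u ?e] by metis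
  \<comment> \<open>Neither index set need contain the other, so the comparison passes through the
    union; the extra terms vanish.\<close>
  also have "\<dots> = (\<Sum>x\<in>?K \<union> ?x ` ?S. ?f x)"
    using finS by (intro sum.mono_neutral_left) (auto simp: in_keys_op)
  also have "\<dots> = (\<Sum>x\<in>?x ` ?S. ?f x)"
  proof (rule sum.mono_neutral_right)
    show "\<forall>y\<in>?K \<union> ?x ` ?S - ?x ` ?S. ?f y = 0" using x by force
  qed (use finS in auto)
  also have "\<dots> = (\<Sum>B\<in>?S. ?f (?x B))" using sum.reindex[OF inj, of ?f] by (simp add: o_def)
  finally show ?thesis using summand by simp
qed

section \<open>Counting the types of bounded degree\<close>

definition types_upto :: "nat \<Rightarrow> nat multiset set" where
  "types_upto n = {M. 0 \<notin># M \<and> sum_mset M \<le> n}"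

lemma sum_mset_ge_size: "(\<And>x. x \<in># M \<Longrightarrow> q \<le> x) \<Longrightarrow> q * size M \<le> sum_mset (M :: nat multiset)"
  by (induction M) (simp_all add: add_le_mono)

text \<open>
  A multiset of sum at most \<open>q ^ 2\<close> has at most \<open>q\<close> elements above \<open>q\<close>; it is encoded by the
  multiplicities of \<open>1, \<dots>, q\<close> and the list of its elements above \<open>q\<close>, padded with zeros.
\<close>

lemma types_upto_square:
  assumes "0 < q"
  shows "finite (types_upto (q ^ 2))" "card (types_upto (q ^ 2)) \<le> ((q ^ 2 + 1) ^ q) ^ 2"
proof -
  let ?L = "{xs :: nat list. set xs \<subseteq> {0..q ^ 2} \<and> length xs = q}"
  define \<phi> where "\<phi> = (\<lambda>(as, bs). (\<Sum>j<q. replicate_mset (as ! j) (Suc j)) +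
    filter_mset (\<lambda>x. x \<noteq> 0) (mset (bs :: nat list)))"
  have fin: "finite ?L" by (rule finite_lists_length_eq) simp
  have sub: "types_upto (q ^ 2) \<subseteq> \<phi> ` (?L \<times> ?L)"
  proof
    fix M assume "M \<in> types_upto (q ^ 2)"
    then have M: "0 \<notin># M" "sum_mset M \<le> q ^ 2" by (auto simp: types_upto_def)
    have elem_le: "x \<le> q ^ 2" if "x \<in># M" for x
      using that M(2) by (simp add: sum_mset.remove[OF that])
    have count_le: "count M x \<le> q ^ 2" for x
    proof -
      have "size M \<le> sum_mset M"
        using sum_mset_ge_size[of M 1] M(1) by (metis One_nat_def Suc_leI mult_1 not_gr_zero)
      then show ?thesis using count_le_size[of M x] M(2) by linarith
    qed
    define N where "N = filter_mset (\<lambda>x. q < x) M"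
    have "q * size N \<le> sum_mset N" by (rule sum_mset_ge_size) (auto simp: N_def)
    also have "\<dots> \<le> sum_mset M"
      unfolding N_def by (metis le_add1 multiset_partition sum_mset.union)
    also have "\<dots> \<le> q * q" using M(2) by (simp add: power2_eq_square)
    finally have N: "size N \<le> q" using assms by simp
    define as where "as = map (\<lambda>j. count M (Suc j)) [0..<q]"
    define bs where "bs = sorted_list_of_multiset N @ replicate (q - size N) 0"
    have len: "length (sorted_list_of_multiset N) = size N"
      by (metis mset_sorted_list_of_multiset size_mset)
    have "as \<in> ?L" using count_le by (auto simp: as_def)
    moreover have "bs \<in> ?L" using N len elem_le by (auto simp: bs_def N_def)
    moreover have "\<phi> (as, bs) = M"
    proof (rule multiset_eqI)
      fix x
      have "count (\<Sum>j<q. replicate_mset (as ! j) (Suc j)) x =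
          (\<Sum>j<q. if Suc j = x then count M x else 0)"
        unfolding count_sum by (intro sum.cong refl) (simp add: as_def)
      also have "\<dots> = (if 0 < x \<and> x \<le> q then count M x else 0)"
        by (cases x) (auto simp: Suc_le_eq)
      finally have 1: "count (\<Sum>j<q. replicate_mset (as ! j) (Suc j)) x =
          (if 0 < x \<and> x \<le> q then count M x else 0)" .
      have 2: "count (filter_mset (\<lambda>x. x \<noteq> 0) (mset bs)) x = (if q < x then count M x else 0)"
        by (auto simp: bs_def N_def)
      show "count (\<phi> (as, bs)) x = count M x"
        using M(1) unfolding \<phi>_def prod.case count_union 1 2 by (cases "x = 0") (auto simp: not_in_iff)
    qed
    ultimately show "M \<in> \<phi> ` (?L \<times> ?L)" by (metis (no_types, lifting) SigmaI imageI)
  qed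
  show "finite (types_upto (q ^ 2))" by (rule finite_subset[OF sub]) (use fin in auto)
  have "card (types_upto (q ^ 2)) \<le> card (\<phi> ` (?L \<times> ?L))"
    by (rule card_mono[OF _ sub]) (use fin in auto)
  also have "\<dots> \<le> card (?L \<times> ?L)" by (rule card_image_le) (use fin in auto)
  also have "\<dots> = ((q ^ 2 + 1) ^ q) ^ 2"
    using card_lists_length_eq[of "{0..q ^ 2}" q]
    by (simp add: card_cartesian_product power2_eq_square)
  finally show "card (types_upto (q ^ 2)) \<le> ((q ^ 2 + 1) ^ q) ^ 2" .
qed

lemma finite_types_upto: "finite (types_upto n)"
proof (rule finite_subset)
  show "types_upto n \<subseteq> types_upto (Suc n ^ 2)"
    by (auto simp: types_upto_def power2_eq_square)
qed (rule types_upto_square, simp)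

text \<open>With \<open>n = q ^ 2\<close> the count has logarithm of order \<open>q\<close> times
  \<open>log q\<close>, whereas \<open>k\<close> may grow like \<open>q ^ 2\<close>.\<close>

lemma card_types_upto_subexponential: "\<exists>k n. k * D \<le> n \<and> card (types_upto n) < 2 ^ k"
proof -
  \<comment> \<open>The powers are chosen so that \<open>k * 2 ^ D = q ^ 2\<close> and
    \<open>k = 2 ^ (D + 9) * (q * 2)\<close>. As \<open>2 * q ^ 2 = 2 ^ (4 * D + 21)\<close>, the
    counting bound then reduces to \<open>4 * D + 21 < 2 ^ (D + 9)\<close>.\<close>
  define q :: nat where "q = 2 ^ (2 * D + 10)"
  define k :: nat where "k = 2 ^ (3 * D + 20)"
  have "D \<le> 2 ^ D" using less_exp[of D] by simp
  then have "k * D \<le> k * 2 ^ D" by simp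
  also have "\<dots> = q ^ 2" by (simp add: k_def q_def flip: power_add power_mult)
  finally have kD: "k * D \<le> q ^ 2" .
  have "q ^ 2 + 1 \<le> 2 * q ^ 2" by (simp add: q_def)
  also have "2 * q ^ 2 = 2 ^ (4 * D + 21)" by (simp add: q_def flip: power_Suc power_mult)
  finally have "((q ^ 2 + 1) ^ q) ^ 2 \<le> ((2 ^ (4 * D + 21)) ^ q) ^ 2"
    by (intro power_mono) auto
  also have "\<dots> = 2 ^ ((4 * D + 21) * q * 2)" by (simp flip: power_mult)
  also have "\<dots> < 2 ^ k"
  proof (rule power_strict_increasing)
    have "4 * D + 21 < 2 ^ (D + 9)"
    proof (induction D)
      case (Suc D)
      have "(512 :: nat) \<le> 2 ^ (D + 9)" using power_increasing[of 9 "D + 9" "2 :: nat"] by simp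
      then have "4 * Suc D + 21 < 2 * 2 ^ (D + 9)" using Suc by simp
      also have "\<dots> = 2 ^ (Suc D + 9)" by (simp flip: power_Suc)
      finally show ?case .
    qed simp
    then have "(4 * D + 21) * (q * 2) < 2 ^ (D + 9) * (q * 2)" by (simp add: q_def)
    also have "\<dots> = k" by (simp add: k_def q_def flip: power_add power_Suc2)
    finally show "(4 * D + 21) * q * 2 < k" by (simp add: mult.assoc)
  qed simp
  finally have "card (types_upto (q ^ 2)) < 2 ^ k"
    using types_upto_square(2)[of q] by (simp add: q_def)
  then show ?thesis using kD by blast
qed

section \<open>Leading coefficients\<close>

definition types_of :: "(dpoly \<Rightarrow> dpoly) \<Rightarrow> nat multiset set" where
  "types_of T = {M. 0 \<notin># M \<and> type_coeff T M \<noteq> 0}"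

lemma (in natural_op) types_of_subset: "types_of T \<subseteq> types_upto D"
  using type_coeff_sum_le by (auto simp: types_of_def types_upto_def)

lemma (in natural_op) finite_types_of: "finite (types_of T)"
  using types_of_subset finite_types_upto finite_subset by blast

lemma (in natural_op) types_of_eq_empty_iff: "types_of T = {} \<longleftrightarrow> T = (\<lambda>p. 0)"
proof
  assume "types_of T = {}"
  then have "op_coeff T m e = 0" for m e
    by (intro coeff_zero_if_type_coeff_zero) (auto simp: types_of_def)
  then show "T = (\<lambda>p. 0)" using apply_eq_zeroI by blast
qed (simp add: types_of_def type_coeff_def op_coeff_def)

text \<open>Size is compared first, because the product formula concerns top order; the linear
  multiset order then decides among types of that size.\<close>

lemma (in natural_op) leading_type:
  assumes "T \<noteq> (\<lambda>p. 0)"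
  obtains L where "L \<in> types_of T" "\<And>M. M \<in> types_of T \<Longrightarrow> size M \<le> size L"
    "\<And>M. M \<in> types_of T \<Longrightarrow> size M = size L \<Longrightarrow> M \<le> L"
proof -
  have fin: "finite (types_of T)" and ne: "types_of T \<noteq> {}"
    using finite_types_of types_of_eq_empty_iff assms by auto
  let ?r = "Max (size ` types_of T)"
  let ?S = "{M \<in> types_of T. size M = ?r}"
  have S: "finite ?S" using fin by simp
  have "?r \<in> size ` types_of T" using fin ne by (intro Max_in) auto
  then have "?S \<noteq> {}" by auto
  then have L: "Max ?S \<in> ?S" using S by (intro Max_in)
  show ?thesis
  proof (rule that[of "Max ?S"])
    show "Max ?S \<in> types_of T" using L by blast
    show "size M \<le> size (Max ?S)" if "M \<in> types_of T" for M
      using L fin that by simp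
    show "M \<le> Max ?S" if "M \<in> types_of T" "size M = size (Max ?S)" for M
      using S L that by (intro Max_ge) auto
  qed
qed

lemma image_mset_nth: "image_mset ((!) xs) (mset_set {..<length xs}) = mset xs"
  by (metis lessThan_atLeast0 map_nth mset_map mset_upt)

lemma natural_op_comp_nonzero:
  assumes T: "natural_op T D" "T \<noteq> (\<lambda>p. 0)" and U: "natural_op U E" "U \<noteq> (\<lambda>p. 0)"
  shows "T \<circ> U \<noteq> (\<lambda>p. 0)"
proof -
  interpret T: natural_op T D by fact
  interpret U: natural_op U E by fact
  obtain L where L: "L \<in> types_of T" "\<And>M. M \<in> types_of T \<Longrightarrow> size M \<le> size L"
    "\<And>M. M \<in> types_of T \<Longrightarrow> size M = size L \<Longrightarrow> M \<le> L"
    using T.leading_type[OF T(2)] by blast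
  obtain K where K: "K \<in> types_of U" "\<And>M. M \<in> types_of U \<Longrightarrow> size M \<le> size K"
    "\<And>M. M \<in> types_of U \<Longrightarrow> size M = size K \<Longrightarrow> M \<le> K"
    using U.leading_type[OF U(2)] by blast
  \<comment> \<open>Positions of \<open>ys @ zs\<close> serve as variables: \<open>K\<close>
    occupies the initial block, \<open>L\<close> the rest, and the type on all of \<open>A\<close>
    is \<open>K + L\<close>.\<close>
  obtain ys zs where ys: "mset ys = K" and zs: "mset zs = L" using ex_mset by metis
  define A where "A = {..<length (ys @ zs)}"
  define g where "g = (!) (ys @ zs)"
  define S where "S = {B. B \<subseteq> A \<and> card B = size K}"
  let ?m = "\<lambda>B. image_mset g (mset_set B)"
  have A: "finite A" "card A = size L + size K" by (auto simp: A_def simp flip: ys zs)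
  have tot: "?m A = K + L" unfolding A_def g_def image_mset_nth by (simp add: ys zs)
  have pos: "0 < g i" if "i \<in> A" for i
  proof -
    have "g i \<in># ?m A" using that A(1) by auto
    then show ?thesis using K(1) L(1) unfolding tot by (auto simp: types_of_def intro!: gr0I)
  qed
  have split: "?m B + ?m (A - B) = K + L" if "B \<subseteq> A" for B
  proof -
    have "mset_set A = mset_set B + mset_set (A - B)"
      using mset_set_Union[of B "A - B"] that A(1) finite_subset[OF that A(1)]
      by (metis Diff_disjoint Diff_partition finite_Diff)
    then show ?thesis using tot by simp
  qed
  have summand: "type_coeff U (?m B) * type_coeff T (?m (A - B)) =
      (if ?m B = K then type_coeff U K * type_coeff T L else 0)" if "B \<in> S" for B
  proof (cases "?m B = K")
    case True
    then show ?thesis using split[of B] that by (simp add: S_def)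
  next
    case False
    have BA: "B \<subseteq> A" "finite B" and cB: "card B = size K"
      using that A(1) finite_subset by (auto simp: S_def)
    have zero: "0 \<notin># ?m B" "0 \<notin># ?m (A - B)" using BA A(1) pos by force+
    have sz: "size (?m B) = size K" "size (?m (A - B)) = size L"
      using cB A BA card_Diff_subset[OF BA(2,1)] by auto
    have "type_coeff U (?m B) = 0 \<or> type_coeff T (?m (A - B)) = 0"
    proof (rule ccontr)
      assume "\<not> ?thesis"
      then have "?m B \<le> K" "?m (A - B) \<le> L"
        using zero sz K(3) L(3) by (auto simp: types_of_def)
      \<comment> \<open>Neither part can exceed its leading type, and one is strictly smaller,
        against the fixed total.\<close>
      then have "?m B + ?m (A - B) < K + L" using False by (intro add_less_le_mono) auto
      then show False using split[OF BA(1)] by simp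
    qed
    then show ?thesis using False by auto
  qed
  have "type_coeff (T \<circ> U) (?m A) =
      (\<Sum>B\<in>S. type_coeff U (?m B) * type_coeff T (?m (A - B)))"
    unfolding S_def by (rule type_coeff_comp[OF T(1) U(1) _ _ A pos])
      (use K(2) L(2) in \<open>auto simp: types_of_def\<close>)
  also have "\<dots> = (\<Sum>B\<in>S. if ?m B = K then type_coeff U K * type_coeff T L else 0)"
    using summand by simp
  \<comment> \<open>Common entries of \<open>K\<close> and \<open>L\<close> allow several such
    \<open>B\<close>. Their terms are all equal, so nothing cancels in characteristic zero.\<close>
  also have "\<dots> = of_nat (card {B \<in> S. ?m B = K}) * (type_coeff U K * type_coeff T L)"
    using A(1) by (simp add: S_def sum.If_cases Int_def)
  finally have eq: "type_coeff (T \<circ> U) (?m A) = \<dots>" .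
  have "?m {..<length ys} = image_mset ((!) ys) (mset_set {..<length ys})"
    by (intro image_mset_cong) (auto simp: g_def nth_append)
  then have "{..<length ys} \<in> {B \<in> S. ?m B = K}"
    unfolding image_mset_nth by (auto simp: S_def A_def simp flip: ys)
  moreover have "finite {B \<in> S. ?m B = K}" using A(1) by (simp add: S_def)
  ultimately have "card {B \<in> S. ?m B = K} \<noteq> 0" by auto
  then have nz: "type_coeff (T \<circ> U) (?m A) \<noteq> 0"
    unfolding eq using K(1) L(1) by (simp add: types_of_def)
  show ?thesis
  proof
    assume "T \<circ> U = (\<lambda>p. 0)"
    then show False using nz by (simp only: type_coeff_def op_coeff_def lookup_zero simp_thms)
  qed
qed

section \<open>The Ore condition\<close>

text \<open>Gaussian elimination without fractions, by induction on the equations.\<close>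

lemma underdetermined_system:
  fixes A :: "'e \<Rightarrow> 's \<Rightarrow> 'a::idom"
  assumes "finite E" "finite S" "card E < card S"
  shows "\<exists>z. (\<exists>s\<in>S. z s \<noteq> 0) \<and> (\<forall>e\<in>E. (\<Sum>s\<in>S. A e s * z s) = 0)"
  using assms
proof (induction E arbitrary: S A rule: finite_induct)
  case empty
  then have "S \<noteq> {}" by auto
  then show ?case by (intro exI[of _ "\<lambda>_. 1"]) auto
next
  case (insert e0 E)
  show ?case
  proof (cases "\<forall>s\<in>S. A e0 s = 0")
    case True
    have "card E < card S" using insert by simp
    from insert.IH[OF insert.prems(1) this, of A] True show ?thesis by auto
  next
    case False
    then obtain s0 where s0: "s0 \<in> S" "A e0 s0 \<noteq> 0" by blast
    let ?S = "S - {s0}"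
    have "finite ?S" "card E < card ?S" using insert s0(1) by auto
    \<comment> \<open>Cross-multiplication with the pivot \<open>A e0 s0\<close> eliminates the
      unknown \<open>s0\<close>.\<close>
    from insert.IH[OF this, of "\<lambda>e s. A e0 s0 * A e s - A e s0 * A e0 s"]
    obtain z where z: "\<exists>s\<in>?S. z s \<noteq> 0"
      "\<forall>e\<in>E. (\<Sum>s\<in>?S. (A e0 s0 * A e s - A e s0 * A e0 s) * z s) = 0" by blast
    \<comment> \<open>Back substitution, scaled by the pivot to avoid division; in a domain the
      nonzero entry of \<open>z\<close> survives.\<close>
    define y where "y = (\<lambda>s. if s = s0 then - (\<Sum>t\<in>?S. A e0 t * z t) else A e0 s0 * z s)"
    have sum: "(\<Sum>s\<in>S. A e s * y s) =
        A e0 s0 * (\<Sum>s\<in>?S. A e s * z s) - A e s0 * (\<Sum>s\<in>?S. A e0 s * z s)" for e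
    proof -
      have "(\<Sum>s\<in>S. A e s * y s) = A e s0 * y s0 + (\<Sum>s\<in>?S. A e s * y s)"
        using s0(1) insert.prems(1) by (simp add: sum.remove)
      moreover have "(\<Sum>s\<in>?S. A e s * y s) = A e0 s0 * (\<Sum>s\<in>?S. A e s * z s)"
        unfolding sum_distrib_left by (intro sum.cong) (auto simp: y_def)
      ultimately show ?thesis by (simp add: y_def)
    qed
    have "(\<Sum>s\<in>S. A e s * y s) = 0" if "e \<in> E" for e
    proof -
      have "(\<Sum>s\<in>S. A e s * y s) = (\<Sum>s\<in>?S. (A e0 s0 * A e s - A e s0 * A e0 s) * z s)"
        unfolding sum by (simp add: sum_distrib_left sum_subtractf left_diff_distrib mult.assoc)
      then show ?thesis using z(2) that by simp
    qed
    moreover have "(\<Sum>s\<in>S. A e0 s * y s) = 0" unfolding sum by simp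
    moreover have "\<exists>s\<in>S. y s \<noteq> 0" using z(1) s0(2) by (auto simp: y_def)
    ultimately show ?thesis by blast
  qed
qed

text \<open>The algebra as plain functions on polynomials in all variables, so that composition
  involves no restrictions; \<open>dop_of\<close> relates it to \<open>J2_carrier\<close>.\<close>

inductive_set steenrod_ops :: "(dpoly \<Rightarrow> dpoly) set" where
  gen: "Jqpow k \<in> steenrod_ops"
| add: "T \<in> steenrod_ops \<Longrightarrow> U \<in> steenrod_ops \<Longrightarrow> (\<lambda>p. T p + U p) \<in> steenrod_ops"
| scale: "T \<in> steenrod_ops \<Longrightarrow> (\<lambda>p. dconst c * T p) \<in> steenrod_ops"
| comp: "T \<in> steenrod_ops \<Longrightarrow> U \<in> steenrod_ops \<Longrightarrow> T \<circ> U \<in> steenrod_ops"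

lemma steenrod_ops_natural: "T \<in> steenrod_ops \<Longrightarrow> \<exists>D. natural_op T D"
  by (induction rule: steenrod_ops.induct)
    (blast intro: natural_op_Jqpow natural_op_add natural_op_scale natural_op_comp)+

lemma steenrod_ops_id: "id \<in> steenrod_ops"
  using steenrod_ops.gen[of 0] by (simp add: Jqpow_0)

lemma steenrod_ops_zero: "(\<lambda>p. 0) \<in> steenrod_ops"
  using steenrod_ops.scale[OF steenrod_ops_id, of 0] by simp

lemma steenrod_ops_sum:
  "(\<And>a. a \<in> A \<Longrightarrow> f a \<in> steenrod_ops) \<Longrightarrow> (\<lambda>p. \<Sum>a\<in>A. f a p) \<in> steenrod_ops"
  by (induction A rule: infinite_finite_induct)
    (auto intro: steenrod_ops_zero steenrod_ops.add)

lemma dconst_minus_one: "dconst (- 1) * p = - p"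
  by (rule poly_mapping_eqI) simp

lemma steenrod_ops_uminus: "T \<in> steenrod_ops \<Longrightarrow> (\<lambda>p. - T p) \<in> steenrod_ops"
  using steenrod_ops.scale[of T "- 1"] by (simp add: dconst_minus_one)

lemma steenrod_ops_comp_eq_zero:
  assumes "T \<in> steenrod_ops" "U \<in> steenrod_ops" "T \<circ> U = (\<lambda>p. 0)"
  shows "T = (\<lambda>p. 0) \<or> U = (\<lambda>p. 0)"
  using assms natural_op_comp_nonzero steenrod_ops_natural by blast

section \<open>Words in two operators\<close>

fun word_op :: "('a \<Rightarrow> 'a) \<Rightarrow> ('a \<Rightarrow> 'a) \<Rightarrow> bool list \<Rightarrow> 'a \<Rightarrow> 'a" where
  "word_op a c [] = id"
| "word_op a c (b # w) = (if b then a else c) \<circ> word_op a c w"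

lemma word_op_steenrod:
  "a \<in> steenrod_ops \<Longrightarrow> c \<in> steenrod_ops \<Longrightarrow> word_op a c w \<in> steenrod_ops"
  by (induction w) (auto intro: steenrod_ops_id steenrod_ops.comp)

lemma natural_op_id: "natural_op id 0"
  using natural_op_Jqpow[of 0] by (simp add: Jqpow_0)

lemma natural_op_word_op:
  assumes "natural_op a D" "natural_op c D"
  shows "natural_op (word_op a c w) (length w * D)"
proof (induction w)
  case (Cons b w)
  then show ?case
    using natural_op_comp[OF assms(1) Cons] natural_op_comp[OF assms(2) Cons]
    by (cases b) (simp_all only: word_op.simps if_True if_False list.size mult_Suc
        add_Suc_right add_0_right)
qed (use natural_op_id in \<open>simp add: id_def\<close>)

definition word_comb ::
  "(dpoly \<Rightarrow> dpoly) \<Rightarrow> (dpoly \<Rightarrow> dpoly) \<Rightarrow> nat \<Rightarrow> (bool list \<Rightarrow> dyadic) \<Rightarrow> dpoly \<Rightarrow> dpoly" where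
  "word_comb a c k z p = (\<Sum>w | length w = k. dconst (z w) * word_op a c w p)"

lemma finite_words: "finite {w :: bool list. length w = k}"
  using finite_lists_length_eq[of "UNIV :: bool set" k] by simp

lemma card_words: "card {w :: bool list. length w = k} = 2 ^ k"
  using card_lists_length_eq[of "UNIV :: bool set" k] by simp

lemma word_comb_steenrod:
  assumes "a \<in> steenrod_ops" "c \<in> steenrod_ops"
  shows "word_comb a c k z \<in> steenrod_ops"
  unfolding word_comb_def by (intro steenrod_ops_sum steenrod_ops.scale word_op_steenrod assms)

lemma type_coeff_word_comb:
  "type_coeff (word_comb a c k z) M = (\<Sum>w | length w = k. type_coeff (word_op a c w) M * z w)"
  by (simp add: type_coeff_def op_coeff_def word_comb_def lookup_sum mult.commute)

text \<open>Words are grouped by their first letter, the operator applied last, which linearity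
  pulls out.\<close>

lemma word_comb_Suc:
  assumes "natural_op a D" "natural_op c D"
  shows "word_comb a c (Suc k) z p = a (word_comb a c k (\<lambda>w. z (True # w)) p) +
    c (word_comb a c k (\<lambda>w. z (False # w)) p)"
proof -
  interpret a: natural_op a D by fact
  interpret c: natural_op c D by fact
  let ?W = "{w :: bool list. length w = k}"
  have W: "{w. length w = Suc k} = (#) True ` ?W \<union> (#) False ` ?W"
    by (auto simp: length_Suc_conv image_iff)
  have inj: "inj_on ((#) b) ?W" for b by (simp add: inj_on_def)
  show ?thesis
    unfolding word_comb_def W a.apply_sum c.apply_sum a.scale c.scale
    using finite_words[of k]
    by (subst sum.union_disjoint) (auto simp: sum.reindex[OF inj])
qed

text \<open>By \<open>indep\<close> both halves of a relation, sorted by first letter, are shorter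
  relations.\<close>

lemma words_independent:
  assumes a: "natural_op a D" and c: "natural_op c D"
    and mem: "a \<in> steenrod_ops" "c \<in> steenrod_ops"
    and indep: "\<And>x y. x \<in> steenrod_ops \<Longrightarrow> y \<in> steenrod_ops \<Longrightarrow>
      (\<And>p. a (x p) + c (y p) = 0) \<Longrightarrow> x = (\<lambda>p. 0) \<and> y = (\<lambda>p. 0)"
    and "word_comb a c k z = (\<lambda>p. 0)" "length w = k"
  shows "z w = 0"
  using assms(6,7)
proof (induction k arbitrary: z w)
  case 0
  \<comment> \<open>The empty word is the identity, so evaluation at the polynomial 1 exposes its
    coefficient.\<close>
  have "dconst (z []) * 1 = 0"
    using fun_cong[OF "0.prems"(1), of 1] by (simp add: word_comb_def)
  then have "lookup (dconst (z [])) 0 = 0" by simp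
  then show ?case using 0 by (simp add: dconst_def)
next
  case (Suc k)
  have "a (word_comb a c k (\<lambda>w. z (True # w)) p) + c (word_comb a c k (\<lambda>w. z (False # w)) p) = 0" for p
    using fun_cong[OF Suc.prems(1), of p] unfolding word_comb_Suc[OF a c] .
  then have "word_comb a c k (\<lambda>w. z (True # w)) = (\<lambda>p. 0)"
    "word_comb a c k (\<lambda>w. z (False # w)) = (\<lambda>p. 0)"
    using indep word_comb_steenrod[OF mem] by blast+
  note zero = this[THEN Suc.IH]
  obtain b v where "w = b # v" "length v = k" using Suc.prems(2) by (auto simp: length_Suc_conv)
  then show ?case using zero by (cases b) auto
qed

lemma steenrod_ops_ore:
  assumes mem: "a \<in> steenrod_ops" "c \<in> steenrod_ops" and c0: "c \<noteq> (\<lambda>p. 0)"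
  shows "\<exists>b\<in>steenrod_ops. \<exists>d\<in>steenrod_ops. d \<noteq> (\<lambda>p. 0) \<and> a \<circ> d = c \<circ> b"
proof (rule ccontr)
  assume no: "\<not> ?thesis"
  obtain D1 D2 where "natural_op a D1" "natural_op c D2" using mem steenrod_ops_natural by blast
  then obtain D where a: "natural_op a D" and c: "natural_op c D"
    by (meson natural_op.mono nat_le_linear)
  interpret c: natural_op c D by fact
  obtain k n where kn: "k * D \<le> n" "card (types_upto n) < 2 ^ k"
    using card_types_upto_subexponential by blast
  \<comment> \<open>One unknown per word of length \<open>k\<close> and one equation per type: there
    are more unknowns than equations.\<close>
  then obtain z where z: "\<exists>w\<in>{w. length w = k}. z w \<noteq> 0"
    "\<forall>M\<in>types_upto n. (\<Sum>w | length w = k. type_coeff (word_op a c w) M * z w) = 0"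
    using underdetermined_system[OF finite_types_upto finite_words,
        of n k "\<lambda>M w. type_coeff (word_op a c w) M"] by (auto simp: card_words)
  have "types_of (word_comb a c k z) = {}"
  proof -
    have "type_coeff (word_comb a c k z) M = 0" if "0 \<notin># M" for M
    proof (cases "M \<in> types_upto n")
      case True
      then show ?thesis using z(2) by (simp add: type_coeff_word_comb)
    next
      case False
      \<comment> \<open>Types outside the system have a sum beyond the degree bound
        \<open>k * D\<close> of every word involved.\<close>
      then have "k * D < sum_mset M" using that kn(1) by (simp add: types_upto_def)
      then have "type_coeff (word_op a c w) M = 0" if "length w = k" for w
        using natural_op.type_coeff_sum_le[OF natural_op_word_op[OF a c], of w M] that by force
      then show ?thesis by (simp add: type_coeff_word_comb)
    qed
    then show ?thesis by (auto simp: types_of_def)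
  qed
  then have "word_comb a c k z = (\<lambda>p. 0)"
    using steenrod_ops_natural[OF word_comb_steenrod[OF mem]] natural_op.types_of_eq_empty_iff
    by blast
  \<comment> \<open>A relation with \<open>x\<close> nonzero would provide the denied pair
    \<open>d = x\<close>, \<open>b = - y\<close>; once \<open>x\<close> vanishes, absence of zero
    divisors kills \<open>y\<close>.\<close>
  moreover have "x = (\<lambda>p. 0) \<and> y = (\<lambda>p. 0)"
    if x: "x \<in> steenrod_ops" and y: "y \<in> steenrod_ops" and xy: "\<And>p. a (x p) + c (y p) = 0" for x y
  proof -
    have neg: "c (- q) = - c q" for q
      using c.scale[of "- 1" q] by (simp add: dconst_minus_one)
    have "a \<circ> x = c \<circ> (\<lambda>p. - y p)"
      using xy by (auto simp: fun_eq_iff neg eq_neg_iff_add_eq_0)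
    then have x0: "x = (\<lambda>p. 0)" using no x steenrod_ops_uminus[OF y] by blast
    have "a 0 = 0" using natural_op.zero[OF a] .
    then have "c \<circ> y = (\<lambda>p. 0)" using xy by (simp add: x0 fun_eq_iff)
    then show ?thesis using steenrod_ops_comp_eq_zero[OF mem(2) y] c0 x0 by blast
  qed
  ultimately have "z w = 0" if "length w = k" for w
    using words_independent[OF a c mem] that by blast
  then show False using z(1) by blast
qed

section \<open>The ring \<open>J2\<close>\<close>

definition dop_of :: "(dpoly \<Rightarrow> dpoly) \<Rightarrow> dop" where
  "dop_of T = (\<lambda>n. restrict T (dpolys n))"

lemma dop_Jq_eq: "dop_Jq k = dop_of (Jqpow k)"
  and dop_zero_eq: "dop_zero = dop_of (\<lambda>p. 0)"
  and dop_one_eq: "dop_one = dop_of id"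
  by (simp_all add: dop_Jq_def dop_of_def dop_zero_def dop_one_def id_def)

lemma dop_add_eq: "dop_add (dop_of T) (dop_of U) = dop_of (\<lambda>p. T p + U p)"
  and dop_smult_eq: "dop_smult c (dop_of T) = dop_of (\<lambda>p. dconst c * T p)"
  by (auto simp: dop_of_def dop_add_def dop_smult_def fun_eq_iff)

text \<open>\<open>U\<close> maps \<open>dpolys n\<close> into itself, so the restriction of
  \<open>T\<close> is only evaluated where it agrees with \<open>T\<close>.\<close>

lemma dop_comp_eq:
  assumes "U \<in> steenrod_ops"
  shows "dop_comp (dop_of T) (dop_of U) = dop_of (T \<circ> U)"
proof -
  obtain E where "natural_op U E" using steenrod_ops_natural[OF assms] by blast
  then show ?thesis
    by (auto simp: dop_of_def dop_comp_def compose_def fun_eq_iff natural_op.keys_apply)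
qed

lemma J2_carrier_eq: "J2_carrier = dop_of ` steenrod_ops"
proof (intro Set.equalityI subsetI)
  show "F \<in> dop_of ` steenrod_ops" if "F \<in> J2_carrier" for F
    using that
  proof induction
    case (gen k)
    then show ?case by (simp add: dop_Jq_eq steenrod_ops.gen)
  next
    case (add F G)
    then show ?case by (auto simp: dop_add_eq steenrod_ops.add)
  next
    case (smult F c)
    then show ?case by (auto simp: dop_smult_eq steenrod_ops.scale)
  next
    case (comp F G)
    then show ?case by (auto simp: dop_comp_eq steenrod_ops.comp)
  qed
next
  have "dop_of T \<in> J2_carrier" if "T \<in> steenrod_ops" for T
    using that
  proof induction
    case (gen k)
    show ?case using J2_carrier.gen[of k] by (simp add: dop_Jq_eq)
  next
    case (add T U)
    then show ?case using J2_carrier.add by (fastforce simp: dop_add_eq)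
  next
    case (scale T c)
    then show ?case using J2_carrier.smult by (fastforce simp: dop_smult_eq)
  next
    case (comp T U)
    then show ?case using J2_carrier.comp[of "dop_of T" "dop_of U"] by (simp only: dop_comp_eq)
  qed
  then show "F \<in> J2_carrier" if "F \<in> dop_of ` steenrod_ops" for F using that by blast
qed

section \<open>Recovering an operator from its restrictions\<close>

lemma rename_mono_comp: "rename_mono g (rename_mono h m) = rename_mono (\<lambda>i. g (h i)) m"
  by (subst rename_mono_def[of h]) (simp add: rename_mono_sum rename_mono_def[of "\<lambda>i. g (h i)"])

lemma rename_mono_id: "rename_mono (\<lambda>i. i) m = m"
  using monom_of_lookup[of "keys m" m] by (simp add: rename_mono_def monom_of_def)

lemma rename_comp: "rename g (rename h p) = rename (\<lambda>i. g (h i)) p"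
  by (induction p rule: dpoly_induct) (simp_all add: rename_add rename_mono_comp)

lemma rename_id: "rename (\<lambda>i. i) p = p"
  by (induction p rule: dpoly_induct) (simp_all add: rename_add rename_mono_id)

lemma rename_Suc_dpolys: "\<exists>n. rename Suc p \<in> dpolys n"
proof -
  let ?V = "\<Union>(keys ` keys (rename Suc p))"
  have "0 \<notin> ?V"
  proof
    assume "0 \<in> ?V"
    then obtain m where m: "m \<in> keys (rename Suc p)" "0 \<in> keys m" by blast
    then obtain m' where "m = rename_mono Suc m'"
      using keys_sum[of "\<lambda>m. single (rename_mono Suc m) (lookup p m)" "keys p"]
      by (auto simp: rename_def split: if_splits)
    then have "lookup m 0 = 0"
      by (simp add: rename_mono_def lookup_sum lookup_single)
    then show False using m(2) by (simp add: in_keys_iff)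
  qed
  moreover have "finite ?V" by simp
  then obtain n where "\<forall>i\<in>?V. i \<le> n" by (meson finite_nat_set_iff_bounded_le)
  ultimately have "?V \<subseteq> {1..n}" by (metis One_nat_def Suc_leI atLeastAtMost_iff not_gr_zero subsetI)
  then have "rename Suc p \<in> dpolys n" unfolding dpolys_def by blast
  then show ?thesis ..
qed

text \<open>
  The variable with index 0 lies in no \<open>dpolys n\<close>, so it is first renamed away.
\<close>

lemma dop_of_inject:
  assumes "T \<in> steenrod_ops" "U \<in> steenrod_ops" "dop_of T = dop_of U"
  shows "T = U"
proof
  fix p
  obtain n where n: "rename Suc p \<in> dpolys n" using rename_Suc_dpolys by blast
  \<comment> \<open>The map \<open>i - 1\<close> undoes \<open>Suc\<close>, and equivariance
    recovers \<open>V p\<close> from the value on the shifted polynomial.\<close>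
  have shift: "V p = rename (\<lambda>i. i - 1) (V (rename Suc p))" if V: "V \<in> steenrod_ops" for V
  proof -
    obtain D where V': "natural_op V D" using steenrod_ops_natural[OF V] by blast
    show ?thesis by (simp add: natural_op.rename[OF V'] rename_comp rename_id)
  qed
  have "T (rename Suc p) = U (rename Suc p)"
    using fun_cong[OF fun_cong[OF assms(3), of n], of "rename Suc p"] n by (simp add: dop_of_def)
  then show "T p = U p" using shift[OF assms(1)] shift[OF assms(2)] by simp
qed

lemma J2_simps:
  "carrier J2 = dop_of ` steenrod_ops" "\<one>\<^bsub>J2\<^esub> = dop_of id" "\<zero>\<^bsub>J2\<^esub> = dop_of (\<lambda>p. 0)"
  "dop_of T \<oplus>\<^bsub>J2\<^esub> dop_of U = dop_of (\<lambda>p. T p + U p)"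
  "U \<in> steenrod_ops \<Longrightarrow> dop_of T \<otimes>\<^bsub>J2\<^esub> dop_of U = dop_of (T \<circ> U)"
  by (simp_all add: J2_def J2_carrier_eq dop_one_eq dop_zero_eq dop_add_eq dop_comp_eq)

lemma ring_J2: "Ring.ring J2"
proof (rule ringI)
  show "abelian_group J2"
  proof (rule abelian_groupI)
    fix F assume "F \<in> carrier J2"
    then obtain T where T: "F = dop_of T" "T \<in> steenrod_ops" by (auto simp: J2_simps)
    then show "\<exists>G\<in>carrier J2. G \<oplus>\<^bsub>J2\<^esub> F = \<zero>\<^bsub>J2\<^esub>"
      by (intro bexI[of _ "dop_of (\<lambda>p. - T p)"]) (auto simp: J2_simps steenrod_ops_uminus)
  qed (auto simp: J2_simps steenrod_ops_zero steenrod_ops.add add_ac)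
  show "monoid J2"
    by (rule monoidI) (auto simp: J2_simps steenrod_ops_id steenrod_ops.comp o_assoc)
next
  fix F G H assume "F \<in> carrier J2" "G \<in> carrier J2" "H \<in> carrier J2"
  then obtain T U V where mem: "T \<in> steenrod_ops" "U \<in> steenrod_ops" "V \<in> steenrod_ops"
    and F: "F = dop_of T" and G: "G = dop_of U" and H: "H = dop_of V"
    by (auto simp: J2_simps)
  obtain D where V: "natural_op V D" using steenrod_ops_natural[OF mem(3)] by blast
  show "(F \<oplus>\<^bsub>J2\<^esub> G) \<otimes>\<^bsub>J2\<^esub> H = F \<otimes>\<^bsub>J2\<^esub> H \<oplus>\<^bsub>J2\<^esub> G \<otimes>\<^bsub>J2\<^esub> H"
    using mem by (simp add: F G H J2_simps steenrod_ops.add o_def)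
  \<comment> \<open>The other distributive law is pointwise; this one rests on additivity of the
    operator \<open>V\<close>.\<close>
  show "H \<otimes>\<^bsub>J2\<^esub> (F \<oplus>\<^bsub>J2\<^esub> G) = H \<otimes>\<^bsub>J2\<^esub> F \<oplus>\<^bsub>J2\<^esub> H \<otimes>\<^bsub>J2\<^esub> G"
    using mem by (simp add: F G H J2_simps steenrod_ops.add o_def natural_op.add[OF V])
qed

text \<open>Everything is transported along \<open>dop_of\<close>, whose injectivity turns equations
  and inequations between families into ones between operators.\<close>

theorem proposition4p1:
  shows "ore_domain J2"
  unfolding ore_domain_def right_ore_def
proof (intro conjI ballI impI)
  show "Ring.ring J2" by (rule ring_J2)
  have "id \<noteq> (\<lambda>p :: dpoly. 0)" by (metis id_apply zero_neq_one)
  then show "\<one>\<^bsub>J2\<^esub> \<noteq> \<zero>\<^bsub>J2\<^esub>"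
    using dop_of_inject[OF steenrod_ops_id steenrod_ops_zero] by (auto simp: J2_simps)
next
  fix F G assume "F \<in> carrier J2" "G \<in> carrier J2" and zero: "F \<otimes>\<^bsub>J2\<^esub> G = \<zero>\<^bsub>J2\<^esub>"
  then obtain T U where mem: "T \<in> steenrod_ops" "U \<in> steenrod_ops"
    and FG: "F = dop_of T" "G = dop_of U"
    by (auto simp: J2_simps)
  have "T \<circ> U = (\<lambda>p. 0)"
    using zero mem by (intro dop_of_inject) (auto simp: FG J2_simps steenrod_ops.comp steenrod_ops_zero)
  then show "F = \<zero>\<^bsub>J2\<^esub> \<or> G = \<zero>\<^bsub>J2\<^esub>"
    using steenrod_ops_comp_eq_zero[OF mem] by (auto simp: FG J2_simps)
next
  fix F G assume "F \<in> carrier J2" "G \<in> carrier J2 - {\<zero>\<^bsub>J2\<^esub>}"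
  then obtain a c where mem: "a \<in> steenrod_ops" "c \<in> steenrod_ops" and c: "c \<noteq> (\<lambda>p. 0)"
    and FG: "F = dop_of a" "G = dop_of c"
    by (auto simp: J2_simps)
  from steenrod_ops_ore[OF mem c] obtain b d where bd: "b \<in> steenrod_ops" "d \<in> steenrod_ops"
      "d \<noteq> (\<lambda>p. 0)" "a \<circ> d = c \<circ> b"
    by blast
  show "\<exists>b\<in>carrier J2. \<exists>d\<in>carrier J2 - {\<zero>\<^bsub>J2\<^esub>}. F \<otimes>\<^bsub>J2\<^esub> d = G \<otimes>\<^bsub>J2\<^esub> b"
  proof (intro bexI)
    show "dop_of d \<in> carrier J2 - {\<zero>\<^bsub>J2\<^esub>}"
      using bd dop_of_inject[OF bd(2) steenrod_ops_zero] by (auto simp: J2_simps)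
  qed (use bd in \<open>auto simp: FG J2_simps\<close>)
qed

end
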